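(* Let $X_{\mathcal O}$ be the Ornithorynque origami. Fix segments $H,V$ in $X_{\mathcal O}$ with $-1<\mathrm{Slope}(H)<0$ and $\mathrm{Slope}(V)>1$. If both segments have length $|H|,|V|\geq\sqrt{288}$ then $$H\cap V\neq\emptyset.$$
   Context: **Origamis.** Let $\mathcal Q$ be a finite set and $(h,v)$ a pair of permutations of $\mathcal Q$ generating a transitive subgroup of the symmetric group. The origami $X$ defined by $(h,v)$ is the surface obtained from the squares $Q_j=\{j\}\times[0,1]^2$, $j\in\mathcal Q$, by gluing (by translation), for every $j$, the right side of $Q_j$ to the left side of $Q_{h(j)}$ and the top side of $Q_j$ to the bottom side of $Q_{v(j)}$. The map $(j,x)\mapsto [x]$ induces a covering $\rho_X:X\to\mathbb T^2=\mathbb R^2/\mathbb Z^2$, ramified only over $[0]$. The points $p_1,\dots,p_m$ of $X$ where $\rho_X$ is ramified are the conical points. **The Ornithorynque.** $X_{\mathcal O}$ is the origami with $\mathcal Q=\mathbb Z/3\mathbb Z\times\mathbb Z/2\mathbb Z\times\mathbb Z/2\mathbb Z$ and, for $i\in\mathbb Z/3\mathbb Z$, $h(i,0,0)=(i+1,1,0)$, $h(i,0,1)=(i-1,1,1)$, $h(i,1,0)=(i,0,0)$, $h(i,1,1)=(i,0,1)$; $v(i,0,0)=(i-1,0,1)$, $v(i,0,1)=(i,0,0)$, $v(i,1,0)=(i+1,1,1)$, $v(i,1,1)=(i,1,0)$. It has genus $4$ and three conical points, each with angle $6\pi$. **Segments.** A (straight) segment in $X$ is a smooth path $S:(a,b)\to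 X\setminus\{p_1,\dots,p_m\}$ such that for some vector $u=(x,y)\in\mathbb R^2$ one has $\frac{d}{dt}\rho_X(S(t))=u$ for all $t\in(a,b)$. Its slope is $\mathrm{Slope}(S)=x/y\in\mathbb R\cup\{\pm\infty\}$ (so slope $0$ is vertical) and its length is $|S|=|b-a|\cdot\|u\|$ (euclidean norm). Endpoints of segments can be conical points. *)

theory Defs
  imports "HOL-Analysis.Analysis"
begin

section \<open>Quotient topologies\<close>

definition quotient_topology :: "'a topology \<Rightarrow> ('a \<times> 'a) set \<Rightarrow> 'a set topology" where
  "quotient_topology T r =
     topology (\<lambda>U. U \<subseteq> topspace T // r \<and> openin T {x \<in> topspace T. r `` {x} \<in> U})"

lemma openin_quotient_topology:
  "openin (quotient_topology T r) U \<longleftrightarrow>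
     U \<subseteq> topspace T // r \<and> openin T {x \<in> topspace T. r `` {x} \<in> U}"
proof -
  have "istopology (\<lambda>U. U \<subseteq> topspace T // r \<and> openin T {x \<in> topspace T. r `` {x} \<in> U})"
    unfolding istopology_def
  proof (rule conjI; intro allI impI)
    fix S U
    assume S: "S \<subseteq> topspace T // r \<and> openin T {x \<in> topspace T. r `` {x} \<in> S}"
      and U: "U \<subseteq> topspace T // r \<and> openin T {x \<in> topspace T. r `` {x} \<in> U}"
    have "{x \<in> topspace T. r `` {x} \<in> S \<inter> U} =
        {x \<in> topspace T. r `` {x} \<in> S} \<inter> {x \<in> topspace T. r `` {x} \<in> U}"
      by auto
    then show "S \<inter> U \<subseteq> topspace T // r \<and> openin T {x \<in> topspace T. r `` {x} \<in> S \<inter> U}"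
      using S U by auto
  next
    fix \<K>
    assume K: "\<forall>K\<in>\<K>. K \<subseteq> topspace T // r \<and> openin T {x \<in> topspace T. r `` {x} \<in> K}"
    have "{x \<in> topspace T. r `` {x} \<in> \<Union>\<K>} = (\<Union>K\<in>\<K>. {x \<in> topspace T. r `` {x} \<in> K})"
      by auto
    then show "\<Union>\<K> \<subseteq> topspace T // r \<and> openin T {x \<in> topspace T. r `` {x} \<in> \<Union>\<K>}"
      using K by auto
  qed
  then show ?thesis
    by (simp add: quotient_topology_def)
qed

lemma topspace_quotient_topology: "topspace (quotient_topology T r) = topspace T // r"
proof
  show "topspace (quotient_topology T r) \<subseteq> topspace T // r"
    using openin_quotient_topology openin_topspace by blast
  have "{x \<in> topspace T. r `` {x} \<in> topspace T // r} = topspace T"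
    by (auto intro: quotientI)
  then have "openin (quotient_topology T r) (topspace T // r)"
    by (simp add: openin_quotient_topology)
  then show "topspace T // r \<subseteq> topspace (quotient_topology T r)"
    by (rule openin_subset)
qed


section \<open>The torus \<open>\<real>\<^sup>2 / \<int>\<^sup>2\<close>\<close>

definition torus_rel :: "((real \<times> real) \<times> (real \<times> real)) set" where
  "torus_rel = {(x, y). fst x - fst y \<in> \<int> \<and> snd x - snd y \<in> \<int>}"

definition torus :: "(real \<times> real) set topology" where
  "torus = quotient_topology euclidean torus_rel"

definition torus_class :: "real \<times> real \<Rightarrow> (real \<times> real) set" where
  "torus_class x = torus_rel `` {x}"

lemma equiv_torus_rel: "equiv UNIV torus_rel"
proof (rule equivI)
  show "refl torus_rel"
    by (auto simp: refl_on_def torus_rel_def)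
  show "sym torus_rel"
    by (auto simp: sym_def torus_rel_def) (metis Ints_minus minus_diff_eq)+
  show "trans torus_rel"
    by (auto simp: trans_def torus_rel_def) (metis Ints_add add_diff_cancel add_diff_eq diff_add_cancel)+
qed auto

lemma torus_class_eq_iff:
  "torus_class x = torus_class y \<longleftrightarrow> fst x - fst y \<in> \<int> \<and> snd x - snd y \<in> \<int>"
  unfolding torus_class_def
  using eq_equiv_class_iff[OF equiv_torus_rel, of x y] by (simp add: torus_rel_def)


section \<open>Origamis\<close>

text \<open>
  The index set of the squares is the whole type \<open>'q\<close>, and \<open>h\<close>, \<open>v\<close> are meant to be
  permutations of it. A point \<open>(j, x)\<close> is the point \<open>x\<close> of the \<open>j\<close>-th copy of the unit square.
\<close>

definition squares :: "('q \<times> real \<times> real) topology" where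
  "squares = prod_topology (discrete_topology UNIV) (top_of_set ({0..1} \<times> {0..1}))"

inductive glue :: "('q \<Rightarrow> 'q) \<Rightarrow> ('q \<Rightarrow> 'q) \<Rightarrow> 'q \<times> real \<times> real \<Rightarrow> 'q \<times> real \<times> real \<Rightarrow> bool"
  for h v where
  right_left: "0 \<le> t \<Longrightarrow> t \<le> 1 \<Longrightarrow> glue h v (j, 1, t) (h j, 0, t)"
| top_bottom: "0 \<le> t \<Longrightarrow> t \<le> 1 \<Longrightarrow> glue h v (j, t, 1) (v j, t, 0)"

definition origami_rel ::
    "('q \<Rightarrow> 'q) \<Rightarrow> ('q \<Rightarrow> 'q) \<Rightarrow> (('q \<times> real \<times> real) \<times> ('q \<times> real \<times> real)) set" where
  "origami_rel h v =
     {(p, q). p \<in> topspace squares \<and> q \<in> topspace squares \<and> equivclp (glue h v) p q}"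

definition origami :: "('q \<Rightarrow> 'q) \<Rightarrow> ('q \<Rightarrow> 'q) \<Rightarrow> ('q \<times> real \<times> real) set topology" where
  "origami h v = quotient_topology squares (origami_rel h v)"

text \<open>
  The covering \<open>\<rho>\<close> of the torus. All representatives \<open>(j, x)\<close> of a point of the origami have the
  same \<open>torus_class x\<close>, see \<open>origami_cover_class\<close> below.
\<close>

definition origami_cover :: "('q \<times> real \<times> real) set \<Rightarrow> (real \<times> real) set" where
  "origami_cover P = the_elem ((\<lambda>(j, x). torus_class x) ` P)"

text \<open>
  The covering is unramified at \<open>p\<close> iff it restricts to a homeomorphism from some open
  neighbourhood of \<open>p\<close> onto an open subset of the torus. A vertex with total angle \<open>2 \<pi>\<close> is
  therefore not a conical point, although it lies above \<open>torus_class 0\<close>.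
\<close>

definition conical_points ::
    "('q \<Rightarrow> 'q) \<Rightarrow> ('q \<Rightarrow> 'q) \<Rightarrow> ('q \<times> real \<times> real) set set" where
  "conical_points h v = {p \<in> topspace (origami h v).
     \<not> (\<exists>U. openin (origami h v) U \<and> p \<in> U \<and> openin torus (origami_cover ` U) \<and>
          homeomorphic_map (subtopology (origami h v) U) (subtopology torus (origami_cover ` U))
            origami_cover)}"

lemma equiv_origami_rel: "equiv (topspace squares) (origami_rel h v)"
proof (rule equivI)
  show "origami_rel h v \<subseteq> topspace squares \<times> topspace squares"
    by (auto simp: origami_rel_def)
  show "refl_on (topspace squares) (origami_rel h v)"
    by (auto simp: refl_on_def origami_rel_def)
  show "sym (origami_rel h v)"
    by (auto simp: sym_def origami_rel_def intro: equivclp_sym)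
  show "trans (origami_rel h v)"
    by (auto simp: trans_def origami_rel_def intro: equivclp_trans)
qed

lemma equivclp_glue_torus_class:
  assumes "equivclp (glue h v) p q"
  shows "torus_class (snd p) = torus_class (snd q)"
  using assms
proof (induction rule: equivclp_induct)
  case (step y z)
  from step(2) have "torus_class (snd y) = torus_class (snd z)"
    by (auto elim!: glue.cases simp: torus_class_eq_iff)
  with step.IH show ?case
    by simp
qed simp

lemma origami_cover_class:
  assumes "(j, x) \<in> topspace squares"
  shows "origami_cover (origami_rel h v `` {(j, x)}) = torus_class x"
proof -
  have "(\<lambda>(j, x). torus_class x) ` (origami_rel h v `` {(j, x)}) = {torus_class x}"
    using assms equivclp_glue_torus_class[of h v "(j, x)"]
    by (force simp: origami_rel_def image_iff)
  then show ?thesis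
    by (simp add: origami_cover_def)
qed


section \<open>Smooth paths and segments\<close>

definition smooth_curve_on :: "real set \<Rightarrow> (real \<Rightarrow> 'a::real_normed_vector) \<Rightarrow> bool" where
  "smooth_curve_on T f \<longleftrightarrow> (\<exists>D :: nat \<Rightarrow> real \<Rightarrow> 'a. D 0 = f \<and>
     (\<forall>k. \<forall>t\<in>T. (D k has_vector_derivative D (Suc k) t) (at t)))"

text \<open>
  Smoothness and derivatives of a path in the torus are those of local lifts to the plane.
\<close>

definition torus_smooth_at :: "(real \<Rightarrow> (real \<times> real) set) \<Rightarrow> real \<Rightarrow> bool" where
  "torus_smooth_at \<gamma> t \<longleftrightarrow> (\<exists>T f. open T \<and> t \<in> T \<and> smooth_curve_on T f \<and>
     (\<forall>s\<in>T. \<gamma> s = torus_class (f s)))"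

definition has_torus_derivative ::
    "(real \<Rightarrow> (real \<times> real) set) \<Rightarrow> real \<times> real \<Rightarrow> real \<Rightarrow> bool" where
  "has_torus_derivative \<gamma> u t \<longleftrightarrow> (\<exists>f. (\<forall>\<^sub>F s in nhds t. \<gamma> s = torus_class (f s)) \<and>
     (f has_vector_derivative u) (at t))"

text \<open>
  Off the conical points, the covering is a local homeomorphism and provides the smooth
  structure; so a continuous path there is smooth iff its projection to the torus is.
\<close>

definition smooth_path ::
    "('q \<Rightarrow> 'q) \<Rightarrow> ('q \<Rightarrow> 'q) \<Rightarrow> real \<Rightarrow> real \<Rightarrow> (real \<Rightarrow> ('q \<times> real \<times> real) set) \<Rightarrow> bool" where
  "smooth_path h v a b S \<longleftrightarrow>
     continuous_map (top_of_set {a<..<b})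
       (subtopology (origami h v) (topspace (origami h v) - conical_points h v)) S \<and>
     (\<forall>t\<in>{a<..<b}. torus_smooth_at (origami_cover \<circ> S) t)"

definition segment ::
    "('q \<Rightarrow> 'q) \<Rightarrow> ('q \<Rightarrow> 'q) \<Rightarrow> real \<Rightarrow> real \<Rightarrow> real \<times> real \<Rightarrow>
       (real \<Rightarrow> ('q \<times> real \<times> real) set) \<Rightarrow> bool" where
  "segment h v a b u S \<longleftrightarrow> a < b \<and> smooth_path h v a b S \<and>
     (\<forall>t\<in>{a<..<b}. has_torus_derivative (origami_cover \<circ> S) u t)"

text \<open>
  The slope is \<open>x / y\<close>, so slope \<open>0\<close> is vertical. By the conventions of type \<open>ereal\<close>, a
  direction \<open>(x, 0)\<close> has slope \<open>\<infinity>\<close> if \<open>x > 0\<close> and \<open>-\<infinity>\<close> if \<open>x < 0\<close>.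
\<close>

definition slope :: "real \<times> real \<Rightarrow> ereal" where
  "slope u = ereal (fst u) / ereal (snd u)"

definition segment_length :: "real \<Rightarrow> real \<Rightarrow> real \<times> real \<Rightarrow> real" where
  "segment_length a b u = \<bar>b - a\<bar> * norm u"


lemma slope_finite: "y \<noteq> 0 \<Longrightarrow> slope (x, y) = ereal (x / y)"
  by (simp add: slope_def)

lemma slope_horizontal: "x > 0 \<Longrightarrow> slope (x, 0) = \<infinity>" "x < 0 \<Longrightarrow> slope (x, 0) = -\<infinity>"
  by (simp_all add: slope_def divide_ereal_def zero_ereal_def[symmetric])


section \<open>The Ornithorynque\<close>

text \<open>
  In the numeral types \<open>3\<close> and \<open>2\<close>, arithmetic is modulo 3 and modulo 2.
\<close>

type_synonym orni_index = "3 \<times> 2 \<times> 2"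

definition orni_h :: "orni_index \<Rightarrow> orni_index" where
  "orni_h = (\<lambda>(i, j, k).
     if j = 0 then (if k = 0 then (i + 1, 1, 0) else (i - 1, 1, 1))
     else (if k = 0 then (i, 0, 0) else (i, 0, 1)))"

definition orni_v :: "orni_index \<Rightarrow> orni_index" where
  "orni_v = (\<lambda>(i, j, k).
     if j = 0 then (if k = 0 then (i - 1, 0, 1) else (i, 0, 0))
     else (if k = 0 then (i + 1, 1, 1) else (i, 1, 0)))"

lemma index_2_cases: "x = 0 \<or> x = 1" for x :: 2
  using exhaust_2[of x] by auto

lemma index_3_cases: "x = 0 \<or> x = 1 \<or> x = -1" for x :: 3
  using exhaust_3[of x] by auto

lemma bij_orni_h: "bij orni_h"
proof -
  have "inj orni_h"
    using index_2_cases by (auto simp: inj_def orni_h_def split: if_splits)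
  then show ?thesis
    by (simp add: bij_def finite_UNIV_inj_surj)
qed

lemma bij_orni_v: "bij orni_v"
proof -
  have "inj orni_v"
    using index_2_cases by (auto simp: inj_def orni_v_def split: if_splits)
  then show ?thesis
    by (simp add: bij_def finite_UNIV_inj_surj)
qed

text \<open>The group generated by \<open>orni_h\<close> and \<open>orni_v\<close> acts transitively.\<close>

lemma orni_transitive: "equivclp (\<lambda>p q. q = orni_h p \<or> q = orni_v p) p q"
proof -
  define R where "R = equivclp (\<lambda>p q. q = orni_h p \<or> q = orni_v p)"
  have h: "R p (orni_h p)" and v: "R p (orni_v p)" for p
    unfolding R_def by (rule r_into_equivclp; simp)+
  have tr: "R x y \<Longrightarrow> R y z \<Longrightarrow> R x z" and sy: "R x y \<Longrightarrow> R y x" for x y z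
    unfolding R_def by (blast intro: equivclp_trans equivclp_sym)+
  have re: "R x x" for x
    unfolding R_def by simp
  have s1: "R (i, 1, 0) (i, 0, 0)" for i
    using h[of "(i, 1, 0)"] by (simp add: orni_h_def)
  have s2: "R (i, 0, 0) (i + 1, 0, 0)" for i
    using tr[OF h[of "(i, 0, 0)"]] s1[of "i + 1"] by (simp add: orni_h_def)
  have s3: "R (i, 0, 1) (i, 0, 0)" for i
    using v[of "(i, 0, 1)"] by (simp add: orni_v_def)
  have s4: "R (i, 1, 1) (i, 0, 0)" for i
    using tr[OF h[of "(i, 1, 1)"]] s3[of i] by (simp add: orni_h_def)
  have s5: "R (i, 0, 0) (0, 0, 0)" for i
    using index_3_cases[of i] s2[of 0] s2[of "-1"] re sy by auto
  have "R p (0, 0, 0)" for p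
  proof -
    obtain i j k where p: "p = (i, j, k)"
      by (cases p)
    have "R p (i, 0, 0)"
      using index_2_cases[of j] index_2_cases[of k] s1[of i] s3[of i] s4[of i] re p by auto
    then show ?thesis
      using s5 tr by blast
  qed
  then have "R p q"
    using tr sy by blast
  then show ?thesis
    by (simp add: R_def)
qed

end

theory Submission
  imports Defs
begin

text \<open>
  A segment lifts to a straight open segment in the plane. Since the covering is injective near a
  nonconical point, such a point lies over exactly one square for each unit cell of the plane
  containing its lift, and the square is locally constant along the part of the segment in the cell.
  Thus the segment is a planar line together with a labelling of the cells it visits by squares, where
  adjacent labels are related by \<open>h\<close> and \<open>v\<close>.

  The length bound gives \<open>H\<close> a height and \<open>V\<close> a width of at least \<open>12\<close>. If \<open>H\<close> enters a square through
  its bottom side, and \<open>V\<close> enters the same square through its bottom or left side, then after a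
  translation of one of them the two planar lines cross in that square or in an adjacent one, at a
  point that has the same label for both, so \<open>H\<close> and \<open>V\<close> meet. It remains to see that the two
  sequences of entered squares have a common member, and a finite check shows that five rows of \<open>H\<close>
  and six columns of \<open>V\<close> always do.
\<close>

section \<open>Points of an origami\<close>

abbreviation unit_square :: "(real \<times> real) set" where
  "unit_square \<equiv> {0..1} \<times> {0..1}"

definition origami_point ::
    "('q \<Rightarrow> 'q) \<Rightarrow> ('q \<Rightarrow> 'q) \<Rightarrow> 'q \<Rightarrow> real \<times> real \<Rightarrow> ('q \<times> real \<times> real) set" where
  "origami_point h v q z = origami_rel h v `` {(q, z)}"

lemma topspace_squares: "topspace squares = UNIV \<times> unit_square"
  by (simp add: squares_def)

lemma topspace_origami: "topspace (origami h v) = topspace squares // origami_rel h v"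
  by (simp add: origami_def topspace_quotient_topology)

lemma origami_point_in_topspace:
  "z \<in> unit_square \<Longrightarrow> origami_point h v q z \<in> topspace (origami h v)"
  unfolding topspace_origami origami_point_def
  by (rule quotientI) (auto simp: topspace_squares)

lemma origami_point_eq_iff:
  assumes "z \<in> unit_square" "z' \<in> unit_square"
  shows "origami_point h v q z = origami_point h v q' z' \<longleftrightarrow> equivclp (glue h v) (q, z) (q', z')"
proof -
  have sq: "(q, z) \<in> topspace squares" "(q', z') \<in> topspace squares"
    using assms by (auto simp: topspace_squares)
  show ?thesis
    unfolding origami_point_def eq_equiv_class_iff[OF equiv_origami_rel sq]
    using sq by (simp add: origami_rel_def)
qed

lemma origami_cover_point:
  "z \<in> unit_square \<Longrightarrow> origami_cover (origami_point h v q z) = torus_class z"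
  unfolding origami_point_def by (rule origami_cover_class) (auto simp: topspace_squares)

lemma origami_point_right_left:
  assumes "0 \<le> t" "t \<le> 1"
  shows "origami_point h v q (1, t) = origami_point h v (h q) (0, t)"
  using assms by (subst origami_point_eq_iff) (auto intro!: r_into_equivclp glue.intros)

lemma origami_point_top_bottom:
  assumes "0 \<le> t" "t \<le> 1"
  shows "origami_point h v q (t, 1) = origami_point h v (v q) (t, 0)"
  using assms by (subst origami_point_eq_iff) (auto intro!: r_into_equivclp glue.intros)

text \<open>Both gluing rules relate boundary points only, so an interior point is alone in its
  class.\<close>

lemma equivclp_glue_interior:
  assumes "equivclp (glue h v) (q, x, y) p" "0 < x" "x < 1" "0 < y" "y < 1"
  shows "p = (q, x, y)"
  using assms(1)
proof (induction rule: equivclp_induct)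
  case (step p p')
  then show ?case
    using assms(2-) by (auto elim!: glue.cases)
qed simp

section \<open>Neighbourhoods and representatives of nonconical points\<close>

lemma nonconical_nbhd:
  assumes "p \<in> topspace (origami h v)" "p \<notin> conical_points h v"
  obtains U where "openin (origami h v) U" "p \<in> U" "inj_on origami_cover U"
proof -
  obtain U where U: "openin (origami h v) U" "p \<in> U"
    "homeomorphic_map (subtopology (origami h v) U) (subtopology torus (origami_cover ` U))
            origami_cover"
    using assms unfolding conical_points_def by blast
  have "inj_on origami_cover U"
    using homeomorphic_imp_injective_map[OF U(3)] openin_subset[OF U(1)]
    by (simp add: inf_absorb2)
  with U that show ?thesis by blast
qed

lemma openin_origami_near:
  assumes "openin (origami h v) U" "origami_point h v q z \<in> U" "z \<in> unit_square"
  obtains e where "e > 0"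
    "\<And>z'. z' \<in> unit_square \<Longrightarrow> dist z' z < e \<Longrightarrow> origami_point h v q z' \<in> U"
proof -
  define W where "W = {x \<in> topspace squares. origami_rel h v `` {x} \<in> U}"
  have "openin squares W"
    using assms(1) by (simp add: W_def origami_def openin_quotient_topology)
  moreover have "(q, z) \<in> W"
    using assms(2,3) by (auto simp: W_def topspace_squares origami_point_def)
  ultimately have "\<exists>A B. openin (discrete_topology UNIV) A \<and> openin (top_of_set unit_square) B \<and>
      q \<in> A \<and> z \<in> B \<and> A \<times> B \<subseteq> W"
    by (simp only: squares_def openin_prod_topology_alt)
  then obtain A B where AB: "q \<in> A" "z \<in> B" "openin (top_of_set unit_square) B"
      "A \<times> B \<subseteq> W"
    by blast
  then obtain e where e: "e > 0" "ball z e \<inter> unit_square \<subseteq> B"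
    unfolding openin_contains_ball by meson
  show ?thesis
  proof (rule that[OF e(1)])
    fix z' assume "z' \<in> unit_square" "dist z' z < e"
    then have "z' \<in> B"
      using e by (auto simp: dist_commute)
    then show "origami_point h v q z' \<in> U"
      using AB by (auto simp: W_def origami_point_def)
  qed
qed

lemma origami_point_inj:
  assumes z: "z \<in> unit_square"
    and eq: "origami_point h v q z = origami_point h v q' z"
    and nc: "origami_point h v q z \<notin> conical_points h v"
  shows "q = q'"
proof -
  \<comment> \<open>Interior points of squares near \<open>z\<close> have only one representative, and the covering separates
    the points of a suitable neighbourhood, so both squares agree there.\<close>
  obtain U where U: "openin (origami h v) U" "origami_point h v q z \<in> U" "inj_on origami_cover U"
    using nonconical_nbhd[OF origami_point_in_topspace[OF z] nc] by blast
  obtain e where e: "e > 0"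
    "\<And>z'. z' \<in> unit_square \<Longrightarrow> dist z' z < e \<Longrightarrow> origami_point h v q z' \<in> U"
    using openin_origami_near[OF U(1,2) z] by metis
  obtain e' where e': "e' > 0"
    "\<And>z'. z' \<in> unit_square \<Longrightarrow> dist z' z < e' \<Longrightarrow> origami_point h v q' z' \<in> U"
    using openin_origami_near[OF U(1) _ z, of q'] U(2) eq by metis
  have "z \<in> closure ({0<..<1} \<times> {0<..<1})"
    using z by (simp add: closure_Times)
  then obtain x y where xy: "(x, y) \<in> {0<..<1} \<times> {0<..<1}" "dist (x, y) z < min e e'"
    using e(1) e'(1) by (metis closure_approachable min_less_iff_conj surj_pair)
  then have sq: "(x, y) \<in> unit_square"
    by auto
  have "origami_point h v q (x, y) = origami_point h v q' (x, y)"
  proof (rule inj_onD[OF U(3)])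
    show "origami_cover (origami_point h v q (x, y)) = origami_cover (origami_point h v q' (x, y))"
      using sq by (simp only: origami_cover_point)
  qed (use e(2) e'(2) sq xy in auto)
  then have "equivclp (glue h v) (q, x, y) (q', x, y)"
    using origami_point_eq_iff[OF sq sq] by metis
  then show ?thesis
    using equivclp_glue_interior xy(1) by fastforce
qed

text \<open>A representative of \<open>p\<close> differs from \<open>z\<close> by an integer vector
  with entries in \<open>{-1, 0, 1}\<close>. It is moved to \<open>z\<close> by crossing a vertical
  side and then a horizontal one; surjectivity of \<open>h\<close> and \<open>v\<close> supplies the
  squares to the left and below.\<close>

lemma origami_point_cover_surj:
  assumes bij: "bij h" "bij v"
    and p: "p \<in> topspace (origami h v)" and z: "z \<in> unit_square"
    and eq: "origami_cover p = torus_class z"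
  shows "\<exists>q. p = origami_point h v q z"
proof -
  obtain q x y where p: "p = origami_point h v q (x, y)" and sq: "(x, y) \<in> unit_square"
    using p unfolding topspace_origami quotient_def origami_point_def topspace_squares by auto
  obtain x' y' where z': "z = (x', y')" by (cases z)
  have "torus_class (x, y) = torus_class z"
    using eq p sq origami_cover_point by metis
  then have Z: "x - x' \<in> \<int>" "y - y' \<in> \<int>"
    by (auto simp: torus_class_eq_iff z')
  have I: "d = 0 \<or> d = 1 \<or> d = -1" if d: "d \<in> \<int>" "\<bar>d\<bar> \<le> 1" for d :: real
  proof -
    obtain k where "d = of_int k" using d(1) by (elim Ints_cases)
    with d(2) have "\<bar>k\<bar> \<le> 1" by linarith
    then have "k = 0 \<or> k = 1 \<or> k = -1" by linarith
    with \<open>d = of_int k\<close> show ?thesis by auto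
  qed
  have "x - x' = 0 \<or> x - x' = 1 \<or> x - x' = -1"
    by (rule I) (use Z sq z z' in auto)
  then have "\<exists>q. p = origami_point h v q (x', y)"
  proof (elim disjE)
    assume "x - x' = 1"
    then have "x = 1" "x' = 0" using sq z z' by auto
    then show ?thesis
      using p sq origami_point_right_left[of y h v q] by auto
  next
    assume "x - x' = -1"
    then have "x = 0" "x' = 1" using sq z z' by auto
    moreover obtain r where "h r = q" using bij by (metis bij_pointE)
    ultimately show ?thesis
      using p sq origami_point_right_left[of y h v r] by auto
  qed (use p in \<open>simp; blast\<close>)
  then obtain r where r: "p = origami_point h v r (x', y)" by blast
  have "y - y' = 0 \<or> y - y' = 1 \<or> y - y' = -1"
    by (rule I) (use Z sq z z' in auto)
  then show ?thesis
  proof (elim disjE)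
    assume "y - y' = 1"
    then have "y = 1" "y' = 0" using sq z z' by auto
    then show ?thesis
      using r z z' origami_point_top_bottom[of x' h v r] by auto
  next
    assume "y - y' = -1"
    then have "y = 0" "y' = 1" using sq z z' by auto
    moreover obtain r' where "v r' = r" using bij by (metis bij_pointE)
    ultimately show ?thesis
      using r z z' origami_point_top_bottom[of x' h v r'] by auto
  qed (use r z' in \<open>simp; blast\<close>)
qed

section \<open>Linear lifts of segments\<close>

text \<open>Meant for the difference of two lifts of one torus path: by continuity it stays within
  distance 1 of \<open>d s\<close>, and lattice points that close coincide, so it is locally
  constant.\<close>

lemma has_vector_derivative_Ints_zero:
  fixes d :: "real \<Rightarrow> real \<times> real"
  assumes d: "(d has_vector_derivative d') (at s)"
    and int: "\<forall>\<^sub>F x in nhds s. fst (d x) \<in> \<int> \<and> snd (d x) \<in> \<int>"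
  shows "d' = 0"
proof -
  have "isCont d s"
    using d by (rule has_vector_derivative_continuous)
  then have "(d \<longlongrightarrow> d s) (nhds s)"
    by (simp add: isCont_def tendsto_at_iff_tendsto_nhds)
  then have "\<forall>\<^sub>F x in nhds s. dist (d x) (d s) < 1"
    by (rule tendstoD) simp
  with int have "\<forall>\<^sub>F x in nhds s. d x = d s"
  proof eventually_elim
    case (elim x)
    have s: "fst (d s) \<in> \<int>" "snd (d s) \<in> \<int>"
      using eventually_nhds_x_imp_x[OF int] by auto
    have "\<bar>fst (d x) - fst (d s)\<bar> < 1" "\<bar>snd (d x) - snd (d s)\<bar> < 1"
      using elim(2) dist_fst_le[of "d x" "d s"] dist_snd_le[of "d x" "d s"]
      by (auto simp: dist_real_def)
    then have "fst (d x) = fst (d s)" "snd (d x) = snd (d s)"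
      using elim(1) s by (metis Ints_diff Ints_nonzero_abs_less1 right_minus_eq)+
    then show ?case
      by (simp add: prod_eq_iff)
  qed
  then obtain T where T: "open T" "s \<in> T" "\<And>x. x \<in> T \<Longrightarrow> d x = d s"
    by (auto simp: eventually_nhds)
  have "(d has_vector_derivative 0) (at s)"
    by (rule has_vector_derivative_transform_within_open[OF has_vector_derivative_const T(1,2)])
      (use T(3) in simp)
  with d show ?thesis
    by (rule vector_derivative_unique_at)
qed

lemma torus_class_add_cancel: "torus_class (x + z) = torus_class (y + z) \<longleftrightarrow> torus_class x = torus_class y"
  by (simp add: torus_class_eq_iff)

text \<open>Each \<open>has_torus_derivative\<close> comes with its own lift. Near the point in
  question it differs from the single smooth lift \<open>f\<close> by lattice points, so
  \<open>f\<close> has derivative \<open>u\<close> on a whole ball and is affine there.\<close>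

lemma torus_curve_local_lift:
  assumes "torus_smooth_at \<gamma> t" and I: "open I" "t \<in> I"
    and der: "\<And>s. s \<in> I \<Longrightarrow> has_torus_derivative \<gamma> u s"
  obtains e c where "e > 0" "ball t e \<subseteq> I" "\<And>s. s \<in> ball t e \<Longrightarrow> \<gamma> s = torus_class (c + s *\<^sub>R u)"
proof -
  obtain T f where T: "open T" "t \<in> T" "smooth_curve_on T f" "\<And>s. s \<in> T \<Longrightarrow> \<gamma> s = torus_class (f s)"
    using assms(1) unfolding torus_smooth_at_def by blast
  obtain f' where f': "\<And>s. s \<in> T \<Longrightarrow> (f has_vector_derivative f' s) (at s)"
    using T(3) unfolding smooth_curve_on_def by metis
  obtain e where e: "e > 0" "ball t e \<subseteq> T \<inter> I"
    using T I by (metis IntI open_Int open_contains_ball)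
  have f'_eq: "f' s = u" if s: "s \<in> ball t e" for s
  proof -
    obtain k where k: "\<forall>\<^sub>F x in nhds s. \<gamma> x = torus_class (k x)" "(k has_vector_derivative u) (at s)"
      using der s e unfolding has_torus_derivative_def by blast
    have "\<forall>\<^sub>F x in nhds s. x \<in> T"
      using T(1) s e by (intro eventually_nhds_in_open) auto
    with k(1) have "\<forall>\<^sub>F x in nhds s. fst (f x - k x) \<in> \<int> \<and> snd (f x - k x) \<in> \<int>"
    proof eventually_elim
      case (elim x)
      then have "torus_class (f x) = torus_class (k x)"
        using T(4) by metis
      then show ?case
        by (simp add: torus_class_eq_iff)
    qed
    moreover have "((\<lambda>x. f x - k x) has_vector_derivative f' s - u) (at s)"
      by (rule has_vector_derivative_diff) (use f' s e k in auto)
    ultimately have "f' s - u = 0"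
      using has_vector_derivative_Ints_zero by blast
    then show ?thesis by simp
  qed
  have "((\<lambda>s. f s - s *\<^sub>R u) has_vector_derivative 0) (at s within ball t e)" if s: "s \<in> ball t e" for s
  proof -
    have "((\<lambda>s. f s - s *\<^sub>R u) has_vector_derivative f' s - (s *\<^sub>R 0 + 1 *\<^sub>R u)) (at s)"
      by (intro has_vector_derivative_diff has_vector_derivative_scaleR f' derivative_intros)
        (use s e in auto)
    then show ?thesis
      using f'_eq[OF s] by (simp add: has_vector_derivative_at_within)
  qed
  then obtain c where c: "\<And>s. s \<in> ball t e \<Longrightarrow> f s - s *\<^sub>R u = c"
    using has_vector_derivative_zero_constant[OF convex_ball] by blast
  show ?thesis
  proof (rule that[OF e(1)])
    fix s assume s: "s \<in> ball t e"
    then have "f s = c + s *\<^sub>R u"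
      using c[OF s] by (simp add: algebra_simps)
    then show "\<gamma> s = torus_class (c + s *\<^sub>R u)"
      using T(4)[of s] s e by auto
  qed (use e in auto)
qed

lemma segment_linear_lift:
  assumes "segment h v a b u S"
  obtains c where "\<And>t. t \<in> {a<..<b} \<Longrightarrow> origami_cover (S t) = torus_class (c + t *\<^sub>R u)"
proof -
  define \<gamma> where "\<gamma> = origami_cover \<circ> S"
  have ab: "a < b" and smooth: "\<And>t. t \<in> {a<..<b} \<Longrightarrow> torus_smooth_at \<gamma> t"
    and der: "\<And>t. t \<in> {a<..<b} \<Longrightarrow> has_torus_derivative \<gamma> u t"
    using assms by (auto simp: segment_def smooth_path_def \<gamma>_def)
  \<comment> \<open>An offset is determined only up to the lattice, so the set of all admissible
    offsets is followed instead of one choice; it is locally constant, hence constant on the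
    connected interval.\<close>
  define G where "G t = {c. \<gamma> t = torus_class (c + t *\<^sub>R u)}" for t
  have loc: "\<exists>e c. e > 0 \<and> (\<forall>s\<in>ball t e. \<gamma> s = torus_class (c + s *\<^sub>R u))" if "t \<in> {a<..<b}" for t
    using torus_curve_local_lift[OF smooth[OF that] open_greaterThanLessThan that der] by metis
  have const: "G t = G s" if "t \<in> {a<..<b}" "s \<in> {a<..<b}" for t s
  proof (rule connected_local_const[of "{a<..<b}" t s G])
    show "\<forall>t\<in>{a<..<b}. \<forall>\<^sub>F s in at t within {a<..<b}. G t = G s"
    proof
      fix t assume "t \<in> {a<..<b}"
      then obtain e c where e: "e > 0" "\<And>s. s \<in> ball t e \<Longrightarrow> \<gamma> s = torus_class (c + s *\<^sub>R u)"
        using loc by metis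
      have "G s = {c'. torus_class c = torus_class c'}" if "s \<in> ball t e" for s
        using e(2)[OF that] by (simp add: G_def torus_class_add_cancel)
      then show "\<forall>\<^sub>F s in at t within {a<..<b}. G t = G s"
        using e(1) unfolding eventually_at
        by (intro exI[of _ e]) (auto simp: dist_commute)
    qed
  qed (use that in auto)
  have "(a + b) / 2 \<in> {a<..<b}"
    using ab by auto
  then obtain c where "c \<in> G ((a + b) / 2)"
    using loc[of "(a + b) / 2"] by (auto simp: G_def)
  then have "c \<in> G t" if "t \<in> {a<..<b}" for t
    using const[OF that \<open>(a + b) / 2 \<in> {a<..<b}\<close>] by simp
  then show ?thesis
    by (intro that[of c]) (simp add: G_def \<gamma>_def)
qed

section \<open>Developing segments into the plane\<close>

definition corner :: "int \<Rightarrow> int \<Rightarrow> real \<times> real" where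
  "corner n j = (of_int n, of_int j)"

definition cell :: "int \<Rightarrow> int \<Rightarrow> (real \<times> real) set" where
  "cell n j = {z. z - corner n j \<in> unit_square}"

lemma in_cell_iff:
  "(x, y) \<in> cell n j \<longleftrightarrow> of_int n \<le> x \<and> x \<le> of_int n + 1 \<and> of_int j \<le> y \<and> y \<le> of_int j + 1"
  by (auto simp: cell_def corner_def)

lemma convex_cell: "convex (cell n j)"
proof -
  have "cell n j = {of_int n..of_int n + 1} \<times> {of_int j..of_int j + 1}"
    by (auto simp: in_cell_iff)
  then show ?thesis
    by (simp add: convex_Times)
qed

text \<open>
  \<open>\<sigma>\<close> names the square of the origami over which each unit cell of the plane lies when the
  subset \<open>L\<close> of the plane is developed onto the subset \<open>S\<close> of the origami; its values at
  cells that \<open>L\<close> does not visit are irrelevant.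
\<close>

definition develops ::
    "('q \<Rightarrow> 'q) \<Rightarrow> ('q \<Rightarrow> 'q) \<Rightarrow> (int \<Rightarrow> int \<Rightarrow> 'q) \<Rightarrow> (real \<times> real) set \<Rightarrow>
       ('q \<times> real \<times> real) set set \<Rightarrow> bool" where
  "develops h v \<sigma> L S \<longleftrightarrow>
     (\<forall>n j. \<forall>z \<in> L \<inter> cell n j. origami_point h v (\<sigma> n j) (z - corner n j) \<in> S) \<and>
     (\<forall>n j. L \<inter> cell n j \<inter> cell (n + 1) j \<noteq> {} \<longrightarrow> \<sigma> (n + 1) j = h (\<sigma> n j)) \<and>
     (\<forall>n j. L \<inter> cell n j \<inter> cell n (j + 1) \<noteq> {} \<longrightarrow> \<sigma> n (j + 1) = v (\<sigma> n j))"

text \<open>The parameters spent in one cell form a convex set \<open>J\<close>, and the label is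
  locally constant on it.\<close>

lemma segment_cell_label_const:
  assumes bij: "bij h" "bij v" and seg: "segment h v a b u S"
    and lift: "\<And>t. t \<in> {a<..<b} \<Longrightarrow> origami_cover (S t) = torus_class (c + t *\<^sub>R u)"
    and t: "t \<in> {a<..<b}" "c + t *\<^sub>R u \<in> cell n j"
    and q: "S t = origami_point h v q (c + t *\<^sub>R u - corner n j)"
    and s: "s \<in> {a<..<b}" "c + s *\<^sub>R u \<in> cell n j"
  shows "S s = origami_point h v q (c + s *\<^sub>R u - corner n j)"
proof -
  define J where "J = {t \<in> {a<..<b}. c + t *\<^sub>R u \<in> cell n j}"
  define z where "z t = c + t *\<^sub>R u - corner n j" for t
  \<comment> \<open>By \<open>origami_point_inj\<close> this set has at most one element off the
    conical points, so comparing these sets compares labels.\<close>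
  define Q where "Q t = {q. S t = origami_point h v q (z t)}" for t
  have z: "z t \<in> unit_square" if "t \<in> J" for t
    using that by (simp add: J_def cell_def z_def)
  have cover: "origami_cover (S t) = torus_class (z t)" if "t \<in> J" for t
    using that lift[of t] by (auto simp: J_def z_def torus_class_eq_iff corner_def)
  have cont: "continuous_map (top_of_set {a<..<b}) (origami h v) S"
    and off: "S t \<in> topspace (origami h v) \<and> S t \<notin> conical_points h v" if "t \<in> {a<..<b}" for t
    using seg that
    by (auto simp: segment_def smooth_path_def continuous_map_in_subtopology)
  have Q: "Q t = {q}" if t: "t \<in> J" and q: "S t = origami_point h v q (z t)" for t q
  proof -
    have "q = r" if "S t = origami_point h v r (z t)" for r
      using origami_point_inj[OF z[OF t], of h v q r] that q off[of t] t by (auto simp: J_def)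
    then show ?thesis
      using q by (auto simp: Q_def)
  qed
  have "convex J"
  proof (rule convexI)
    fix x y \<alpha> \<beta> :: real
    assume xy: "x \<in> J" "y \<in> J" and ab: "0 \<le> \<alpha>" "0 \<le> \<beta>" "\<alpha> + \<beta> = 1"
    have "\<alpha> *\<^sub>R x + \<beta> *\<^sub>R y \<in> {a<..<b}"
      using xy ab by (intro convexD[of "{a<..<b}"]) (auto simp: J_def)
    moreover have "\<alpha> *\<^sub>R (c + x *\<^sub>R u) + \<beta> *\<^sub>R (c + y *\<^sub>R u) \<in> cell n j"
      using xy ab by (intro convexD[OF convex_cell]) (auto simp: J_def)
    moreover have "\<alpha> *\<^sub>R (c + x *\<^sub>R u) + \<beta> *\<^sub>R (c + y *\<^sub>R u) = (\<alpha> + \<beta>) *\<^sub>R c + (\<alpha> *\<^sub>R x + \<beta> *\<^sub>R y) *\<^sub>R u"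
      by (simp add: algebra_simps)
    ultimately show "\<alpha> *\<^sub>R x + \<beta> *\<^sub>R y \<in> J"
      by (simp add: J_def ab)
  qed
  have "Q t = Q s"
  proof (rule connected_local_const[of J])
    show "connected J"
      using \<open>convex J\<close> by (rule convex_connected)
    show "t \<in> J" "s \<in> J"
      using t s by (auto simp: J_def)
    show "\<forall>t\<in>J. \<forall>\<^sub>F s in at t within J. Q t = Q s"
    proof
      fix t assume t: "t \<in> J"
      then have tI: "t \<in> {a<..<b}"
        by (simp add: J_def)
      obtain p where p: "S t = origami_point h v p (z t)"
        using origami_point_cover_surj[OF bij _ z[OF t] cover[OF t]] off[OF tI] by blast
      obtain U where U: "openin (origami h v) U" "S t \<in> U" "inj_on origami_cover U"
        using nonconical_nbhd off[OF tI] by blast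
      obtain e where e: "e > 0"
        "\<And>z'. z' \<in> unit_square \<Longrightarrow> dist z' (z t) < e \<Longrightarrow> origami_point h v p z' \<in> U"
        using openin_origami_near[OF U(1) _ z[OF t], of p] U(2) p by metis
      have "openin (top_of_set {a<..<b}) {s \<in> {a<..<b}. S s \<in> U}"
        using openin_continuous_map_preimage[OF cont[OF tI] U(1)] by simp
      then have "open {s \<in> {a<..<b}. S s \<in> U}"
        by (simp add: openin_open_eq)
      then have "\<forall>\<^sub>F s in at t within J. s \<in> {s \<in> {a<..<b}. S s \<in> U}"
        by (rule eventually_at_in_open'[THEN filter_leD[OF at_le, rotated]])
           (use U(2) tI in auto)
      moreover have "(z \<longlongrightarrow> z t) (at t within J)"
        unfolding z_def by (intro tendsto_intros)
      then have "\<forall>\<^sub>F s in at t within J. dist (z s) (z t) < e"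
        using e(1) by (rule tendstoD)
      moreover have "\<forall>\<^sub>F s in at t within J. s \<in> J"
        by (auto simp: eventually_at_filter)
      ultimately show "\<forall>\<^sub>F s in at t within J. Q t = Q s"
      proof eventually_elim
        case (elim s)
        \<comment> \<open>Both points lie in \<open>U\<close> and over the same point of the torus,
          and the covering is injective on \<open>U\<close>.\<close>
        have "S s = origami_point h v p (z s)"
        proof (rule inj_onD[OF U(3)])
          show "origami_cover (S s) = origami_cover (origami_point h v p (z s))"
            using cover[OF elim(3)] origami_cover_point[OF z[OF elim(3)], of h v p] by simp
        qed (use elim e(2)[OF z] in auto)
        then show ?case
          using Q[OF t p] Q[OF elim(3)] by simp
      qed
    qed
  qed
  then show ?thesis
    using q by (auto simp: Q_def z_def)
qed

lemma segment_develops: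
  assumes bij: "bij h" "bij v" and seg: "segment h v a b u S"
  obtains c \<sigma> where "develops h v \<sigma> ((\<lambda>t. c + t *\<^sub>R u) ` {a<..<b}) (S ` {a<..<b})"
proof -
  obtain c where lift: "\<And>t. t \<in> {a<..<b} \<Longrightarrow> origami_cover (S t) = torus_class (c + t *\<^sub>R u)"
    using segment_linear_lift[OF seg] by blast
  \<comment> \<open>Any time at which the cell is visited may fix its label: by
    \<open>segment_cell_label_const\<close> that label is right at all other such times.\<close>
  define \<sigma> where "\<sigma> n j = (SOME q. \<exists>t\<in>{a<..<b}. c + t *\<^sub>R u \<in> cell n j \<and>
      S t = origami_point h v q (c + t *\<^sub>R u - corner n j))" for n j
  have off: "S t \<in> topspace (origami h v)" "S t \<notin> conical_points h v" if "t \<in> {a<..<b}" for t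
    using seg that
    by (auto simp: segment_def smooth_path_def continuous_map_in_subtopology)
  have lab: "S t = origami_point h v (\<sigma> n j) (c + t *\<^sub>R u - corner n j)"
    if t: "t \<in> {a<..<b}" "c + t *\<^sub>R u \<in> cell n j" for t n j
  proof -
    have "origami_cover (S t) = torus_class (c + t *\<^sub>R u - corner n j)"
      using lift[OF t(1)] by (simp add: torus_class_eq_iff corner_def)
    then have "\<exists>q. S t = origami_point h v q (c + t *\<^sub>R u - corner n j)"
      using origami_point_cover_surj[OF bij off(1)[OF t(1)]] t(2) by (auto simp: cell_def)
    then have "\<exists>q. \<exists>t\<in>{a<..<b}. c + t *\<^sub>R u \<in> cell n j \<and>
      S t = origami_point h v q (c + t *\<^sub>R u - corner n j)"
      using t by blast
    then have "\<exists>t\<in>{a<..<b}. c + t *\<^sub>R u \<in> cell n j \<and>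
      S t = origami_point h v (\<sigma> n j) (c + t *\<^sub>R u - corner n j)"
      unfolding \<sigma>_def by (rule someI_ex)
    then show ?thesis
      using segment_cell_label_const[OF bij seg lift] t by blast
  qed
  have right: "\<sigma> (n + 1) j = h (\<sigma> n j)"
    if t: "t \<in> {a<..<b}" "c + t *\<^sub>R u \<in> cell n j" "c + t *\<^sub>R u \<in> cell (n + 1) j" for t n j
  proof -
    obtain x y where xy: "c + t *\<^sub>R u = (x, y)" by (cases "c + t *\<^sub>R u")
    then have x: "x = of_int n + 1" and y: "of_int j \<le> y" "y \<le> of_int j + 1"
      using t(2,3) by (auto simp: in_cell_iff)
    \<comment> \<open>On the common side both labels describe \<open>S t\<close> with the same local
      coordinates, and \<open>S t\<close> is nonconical, so \<open>origami_point_inj\<close>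
      identifies the squares.\<close>
    have "S t = origami_point h v (\<sigma> (n + 1) j) (0, y - of_int j)"
      using lab[OF t(1,3)] by (simp add: xy x corner_def)
    moreover have "S t = origami_point h v (h (\<sigma> n j)) (0, y - of_int j)"
      using lab[OF t(1,2)] origami_point_right_left[of "y - of_int j" h v "\<sigma> n j"] y
      by (simp add: xy x corner_def)
    ultimately show ?thesis
      using origami_point_inj[of "(0, y - of_int j)" h v] off(2)[OF t(1)] y by auto
  qed
  have up: "\<sigma> n (j + 1) = v (\<sigma> n j)"
    if t: "t \<in> {a<..<b}" "c + t *\<^sub>R u \<in> cell n j" "c + t *\<^sub>R u \<in> cell n (j + 1)" for t n j
  proof -
    obtain x y where xy: "c + t *\<^sub>R u = (x, y)" by (cases "c + t *\<^sub>R u")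
    then have y: "y = of_int j + 1" and x: "of_int n \<le> x" "x \<le> of_int n + 1"
      using t(2,3) by (auto simp: in_cell_iff)
    have "S t = origami_point h v (\<sigma> n (j + 1)) (x - of_int n, 0)"
      using lab[OF t(1,3)] by (simp add: xy y corner_def)
    moreover have "S t = origami_point h v (v (\<sigma> n j)) (x - of_int n, 0)"
      using lab[OF t(1,2)] origami_point_top_bottom[of "x - of_int n" h v "\<sigma> n j"] x
      by (simp add: xy y corner_def)
    ultimately show ?thesis
      using origami_point_inj[of "(x - of_int n, 0)" h v] off(2)[OF t(1)] x by auto
  qed
  show ?thesis
  proof (rule that[of \<sigma> c], unfold develops_def, intro conjI allI ballI impI)
    fix n j z assume "z \<in> (\<lambda>t. c + t *\<^sub>R u) ` {a<..<b} \<inter> cell n j"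
    then obtain t where "t \<in> {a<..<b}" "z = c + t *\<^sub>R u" "c + t *\<^sub>R u \<in> cell n j"
      by blast
    then show "origami_point h v (\<sigma> n j) (z - corner n j) \<in> S ` {a<..<b}"
      using lab by (metis imageI)
  qed (use right up in blast)+
qed

section \<open>Crossing lines\<close>

lemma developsD:
  assumes "develops h v \<sigma> L S" "(x, y) \<in> L" "(x, y) \<in> cell n j"
  shows "origami_point h v (\<sigma> n j) (x - of_int n, y - of_int j) \<in> S"
  using assms by (force simp: develops_def corner_def)

text \<open>The chord between the two given points stays in \<open>L\<close> and crosses the common
  side of the two cells; \<open>develops\<close> applies at the crossing. \<open>develops_up\<close>
  is the same with the coordinates exchanged.\<close>

lemma develops_right:
  assumes dev: "develops h v \<sigma> L S" and "convex L"
    and z: "(x, y) \<in> L" "(x, y) \<in> cell n j" and z': "(x', y') \<in> L" "(x', y') \<in> cell (n + 1) j"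
  shows "\<sigma> (n + 1) j = h (\<sigma> n j)"
proof -
  let ?w = "of_int n + 1 :: real"
  have x: "x \<le> ?w" "?w \<le> x'"
    using z(2) z'(2) by (auto simp: in_cell_iff)
  have "\<exists>y''. (?w, y'') \<in> L \<and> of_int j \<le> y'' \<and> y'' \<le> of_int j + 1"
  proof (cases "x = x'")
    case True
    then have "x = ?w" using x by simp
    then show ?thesis
      using z by (auto simp: in_cell_iff)
  next
    case False
    define \<alpha> where "\<alpha> = (?w - x) / (x' - x)"
    have "\<alpha> * (x' - x) = ?w - x"
      using False by (simp add: \<alpha>_def)
    then have "(1 - \<alpha>) * x + \<alpha> * x' = ?w"
      by (simp only: algebra_simps)
    moreover have "0 \<le> \<alpha>" "\<alpha> \<le> 1"
      using x False by (simp_all add: \<alpha>_def divide_le_eq)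
    ultimately have \<alpha>: "0 \<le> \<alpha>" "\<alpha> \<le> 1" "(1 - \<alpha>) * x + \<alpha> * x' = ?w"
      by auto
    have "(1 - \<alpha>) *\<^sub>R (x, y) + \<alpha> *\<^sub>R (x', y') \<in> L"
      using \<alpha> by (intro convexD[OF \<open>convex L\<close> z(1) z'(1)]) auto
    moreover have "(1 - \<alpha>) *\<^sub>R y + \<alpha> *\<^sub>R y' \<in> {of_int j..of_int j + 1}"
      using \<alpha> z(2) z'(2) by (intro convexD) (auto simp: in_cell_iff)
    ultimately show ?thesis
      using \<alpha>(3) by auto
  qed
  then obtain y'' where "(?w, y'') \<in> L \<inter> cell n j \<inter> cell (n + 1) j"
    by (auto simp: in_cell_iff)
  then show ?thesis
    using dev unfolding develops_def by blast
qed

lemma develops_up: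
  assumes dev: "develops h v \<sigma> L S" and "convex L"
    and z: "(x, y) \<in> L" "(x, y) \<in> cell n j" and z': "(x', y') \<in> L" "(x', y') \<in> cell n (j + 1)"
  shows "\<sigma> n (j + 1) = v (\<sigma> n j)"
proof -
  let ?w = "of_int j + 1 :: real"
  have y: "y \<le> ?w" "?w \<le> y'"
    using z(2) z'(2) by (auto simp: in_cell_iff)
  have "\<exists>x''. (x'', ?w) \<in> L \<and> of_int n \<le> x'' \<and> x'' \<le> of_int n + 1"
  proof (cases "y = y'")
    case True
    then have "y = ?w" using y by simp
    then show ?thesis
      using z by (auto simp: in_cell_iff)
  next
    case False
    define \<alpha> where "\<alpha> = (?w - y) / (y' - y)"
    have "\<alpha> * (y' - y) = ?w - y"
      using False by (simp add: \<alpha>_def)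
    then have "(1 - \<alpha>) * y + \<alpha> * y' = ?w"
      by (simp only: algebra_simps)
    moreover have "0 \<le> \<alpha>" "\<alpha> \<le> 1"
      using y False by (simp_all add: \<alpha>_def divide_le_eq)
    ultimately have \<alpha>: "0 \<le> \<alpha>" "\<alpha> \<le> 1" "(1 - \<alpha>) * y + \<alpha> * y' = ?w"
      by auto
    have "(1 - \<alpha>) *\<^sub>R (x, y) + \<alpha> *\<^sub>R (x', y') \<in> L"
      using \<alpha> by (intro convexD[OF \<open>convex L\<close> z(1) z'(1)]) auto
    moreover have "(1 - \<alpha>) *\<^sub>R x + \<alpha> *\<^sub>R x' \<in> {of_int n..of_int n + 1}"
      using \<alpha> z(2) z'(2) by (intro convexD) (auto simp: in_cell_iff)
    ultimately show ?thesis
      using \<alpha>(3) by auto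
  qed
  then obtain x'' where "(x'', ?w) \<in> L \<inter> cell n j \<inter> cell n (j + 1)"
    by (auto simp: in_cell_iff)
  then show ?thesis
    using dev unfolding develops_def by blast
qed

text \<open>Equal labels at the base cells pass to a side neighbour, through \<open>h\<close> or
  \<open>v\<close> to the right and upwards, through their injectivity to the left and downwards.
  The base points certify that both sets visit their base cells. The region in \<open>near\<close>
  is a cross because a diagonal neighbour is not one step away.\<close>

lemma develops_meet:
  assumes inj: "inj h" "inj v"
    and H: "develops h v \<sigma> L S" "convex L" and V: "develops h v \<tau> M T" "convex M"
    and same: "\<sigma> n j = \<tau> n' j'"
    and base: "(of_int n + x0, of_int j + y0) \<in> L" "(of_int n' + x1, of_int j' + y1) \<in> M"
      "(x0, y0) \<in> unit_square" "(x1, y1) \<in> unit_square"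
    and meet: "(of_int n + x, of_int j + y) \<in> L" "(of_int n' + x, of_int j' + y) \<in> M"
    and near: "(x, y) \<in> {0..1} \<times> {-1..2} \<union> {-1..2} \<times> {0..1}"
  shows "S \<inter> T \<noteq> {}"
proof -
  \<comment> \<open>It suffices that the labels agree on the cell at offset \<open>(k, l)\<close>
    containing the crossing: both sets then contain the same origami point.\<close>
  have cross: "S \<inter> T \<noteq> {}"
    if "\<sigma> (n + k) (j + l) = \<tau> (n' + k) (j' + l)" "of_int k \<le> x" "x \<le> of_int k + 1"
      "of_int l \<le> y" "y \<le> of_int l + 1" for k l
  proof -
    have "origami_point h v (\<sigma> (n + k) (j + l)) (x - of_int k, y - of_int l) \<in> S"
      using developsD[OF H(1) meet(1), of "n + k" "j + l"] that(2-) by (simp add: in_cell_iff)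
    moreover have "origami_point h v (\<tau> (n' + k) (j' + l)) (x - of_int k, y - of_int l) \<in> T"
      using developsD[OF V(1) meet(2), of "n' + k" "j' + l"] that(2-) by (simp add: in_cell_iff)
    ultimately show ?thesis
      using that(1) by auto
  qed
  have c0: "(of_int n + x0, of_int j + y0) \<in> cell n j" "(of_int n' + x1, of_int j' + y1) \<in> cell n' j'"
    using base by (auto simp: in_cell_iff)
  consider "0 \<le> x" "x \<le> 1" "0 \<le> y" "y \<le> 1" | "0 \<le> y" "y \<le> 1" "1 \<le> x" "x \<le> 2"
    | "0 \<le> y" "y \<le> 1" "-1 \<le> x" "x \<le> 0" | "0 \<le> x" "x \<le> 1" "1 \<le> y" "y \<le> 2"
    | "0 \<le> x" "x \<le> 1" "-1 \<le> y" "y \<le> 0"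
  proof -
    from near have "0 \<le> x \<and> x \<le> 1 \<and> -1 \<le> y \<and> y \<le> 2 \<or> -1 \<le> x \<and> x \<le> 2 \<and> 0 \<le> y \<and> y \<le> 1"
      by auto
    then show ?thesis
      using that by linarith
  qed
  then show ?thesis
  proof cases
    case 1
    then show ?thesis
      using cross[of 0 0] same by simp
  next
    case 2
    have "\<sigma> (n + 1) j = h (\<sigma> n j)"
      by (rule develops_right[OF H base(1) c0(1) meet(1)]) (use 2 in \<open>simp add: in_cell_iff\<close>)
    moreover have "\<tau> (n' + 1) j' = h (\<tau> n' j')"
      by (rule develops_right[OF V base(2) c0(2) meet(2)]) (use 2 in \<open>simp add: in_cell_iff\<close>)
    ultimately show ?thesis
      using cross[of 1 0] same 2 by simp
  next
    case 3
    have "\<sigma> (n - 1 + 1) j = h (\<sigma> (n - 1) j)"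
      by (rule develops_right[OF H meet(1) _ base(1)]) (use 3 c0 in \<open>simp_all add: in_cell_iff\<close>)
    moreover have "\<tau> (n' - 1 + 1) j' = h (\<tau> (n' - 1) j')"
      by (rule develops_right[OF V meet(2) _ base(2)]) (use 3 c0 in \<open>simp_all add: in_cell_iff\<close>)
    ultimately have "\<sigma> (n - 1) j = \<tau> (n' - 1) j'"
      using same inj(1) by (simp add: inj_eq)
    then show ?thesis
      using cross[of "-1" 0] 3 by simp
  next
    case 4
    have "\<sigma> n (j + 1) = v (\<sigma> n j)"
      by (rule develops_up[OF H base(1) c0(1) meet(1)]) (use 4 in \<open>simp add: in_cell_iff\<close>)
    moreover have "\<tau> n' (j' + 1) = v (\<tau> n' j')"
      by (rule develops_up[OF V base(2) c0(2) meet(2)]) (use 4 in \<open>simp add: in_cell_iff\<close>)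
    ultimately show ?thesis
      using cross[of 0 1] same 4 by simp
  next
    case 5
    have "\<sigma> n (j - 1 + 1) = v (\<sigma> n (j - 1))"
      by (rule develops_up[OF H meet(1) _ base(1)]) (use 5 c0 in \<open>simp_all add: in_cell_iff\<close>)
    moreover have "\<tau> n' (j' - 1 + 1) = v (\<tau> n' (j' - 1))"
      by (rule develops_up[OF V meet(2) _ base(2)]) (use 5 c0 in \<open>simp_all add: in_cell_iff\<close>)
    ultimately have "\<sigma> n (j - 1) = \<tau> n' (j' - 1)"
      using same inj(2) by (simp add: inj_eq)
    then show ?thesis
      using cross[of 0 "-1"] 5 by simp
  qed
qed

section \<open>Straight lines and the place where two of them cross\<close>

definition steep_line :: "real \<Rightarrow> real \<Rightarrow> real set \<Rightarrow> (real \<times> real) set" where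
  "steep_line s \<xi> I = (\<lambda>y. (\<xi> - s * y, y)) ` I"

text \<open>A steep line has \<open>slope\<close> equal to \<open>- s\<close>, whereas
  \<open>m\<close> is the reciprocal of the slope of a flat line, so that slope
  \<open>\<infinity>\<close> is included as \<open>m = 0\<close>.\<close>

definition flat_line :: "real \<Rightarrow> real \<Rightarrow> real set \<Rightarrow> (real \<times> real) set" where
  "flat_line m \<beta> I = (\<lambda>x. (x, \<beta> + m * x)) ` I"

lemma in_steep_line: "(x, y) \<in> steep_line s \<xi> I \<longleftrightarrow> x = \<xi> - s * y \<and> y \<in> I"
  by (auto simp: steep_line_def)

lemma in_flat_line: "(x, y) \<in> flat_line m \<beta> I \<longleftrightarrow> y = \<beta> + m * x \<and> x \<in> I"
  by (auto simp: flat_line_def)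

lemma convex_steep_line:
  assumes "convex I" shows "convex (steep_line s \<xi> I)"
proof -
  have "steep_line s \<xi> I = (+) (\<xi>, 0) ` ((\<lambda>y. (- s * y, y)) ` I)"
    by (auto simp: steep_line_def image_image)
  moreover have "linear (\<lambda>y. (- s * y, y))"
    by (rule linearI) (auto simp: algebra_simps)
  ultimately show ?thesis
    using assms by (auto intro!: convex_translation convex_linear_image)
qed

lemma convex_flat_line:
  assumes "convex I" shows "convex (flat_line m \<beta> I)"
proof -
  have "flat_line m \<beta> I = (+) (0, \<beta>) ` ((\<lambda>x. (x, m * x)) ` I)"
    by (auto simp: flat_line_def image_image)
  moreover have "linear (\<lambda>x. (x, m * x))"
    by (rule linearI) (auto simp: algebra_simps)
  ultimately show ?thesis
    using assms by (auto intro!: convex_translation convex_linear_image)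
qed

text \<open>The steep line enters the unit square at \<open>(x0, 0)\<close>, the flat one at
  \<open>(e, f)\<close> on the left or bottom side. For \<open>f = 0\<close> they cross in the
  square or below it; otherwise \<open>e = 0\<close>, and they cross in the square, above it or to
  its left.\<close>

lemma line_intersection_near:
  fixes s m x0 e f :: real
  assumes s: "0 < s" "s < 1" and m: "0 \<le> m" "m < 1" and x0: "0 \<le> x0" "x0 \<le> 1"
    and e: "0 \<le> e" "e \<le> 1" and f: "0 \<le> f" "f \<le> 1" and ef: "e = 0 \<or> f = 0"
  obtains x y where "x = x0 - s * y" "y = f + m * (x - e)"
    "(x, y) \<in> {0..1} \<times> {-1..2} \<union> {-1..1} \<times> {0..1}"
proof -
  \<comment> \<open>The two lines meet at the height \<open>y\<close> below; \<open>k\<close> is the determinant of the linear system.\<close>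
  define k where "k = 1 + m * s"
  have k: "k \<ge> 1"
    using s m by (simp add: k_def)
  define y where "y = (f + m * (x0 - e)) / k"
  define x where "x = x0 - s * y"
  have yk: "y * k = f + m * (x0 - e)"
    using k by (simp add: y_def)
  have xk: "x * k = x0 - s * f + m * s * e"
  proof -
    have "x * k = x0 * k - s * (y * k)"
      by (simp add: x_def algebra_simps)
    then show ?thesis
      by (simp add: yk) (simp add: k_def algebra_simps)
  qed
  have xy: "y = f + m * (x - e)"
    using yk by (simp add: x_def k_def algebra_simps)
  have ms: "0 \<le> m * s" "m * s \<le> m" "m * x0 \<le> m" "m * e \<le> m" "0 \<le> m * x0" "0 \<le> m * e"
    using s m x0 e by (auto intro: mult_left_le)
  have sf: "0 \<le> s * f" "s * f \<le> s"
    using s f by (auto intro: mult_left_le)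
  show ?thesis
  proof (rule that[of x y])
    show "(x, y) \<in> {0..1} \<times> {-1..2} \<union> {-1..1} \<times> {0..1}"
    proof (cases "f = 0")
      case True
      have "0 * k \<le> x * k"
        unfolding xk using True x0 ms e s m by simp
      moreover have "m * s * e \<le> m * s"
        using ms e by (intro mult_left_le) auto
      then have "x * k \<le> 1 * k"
        using xk x0 True k_def by (simp del: mult_le_cancel_right1)
      moreover have "-1 * k \<le> y * k" "y * k \<le> 1 * k"
        unfolding yk using True ms m k by (simp_all add: algebra_simps)
      ultimately have "0 \<le> x" "x \<le> 1" "-1 \<le> y" "y \<le> 1"
        using k mult_right_le_imp_le[of _ k] by (metis zero_less_one less_le_trans)+
      then show ?thesis by auto
    next
      case False
      then have e0: "e = 0" using ef by simp
      have "0 * k \<le> y * k" "y * k \<le> 2 * k"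
        unfolding yk using e0 f m ms k by simp_all
      moreover have "x * k = x0 - s * f"
        using xk e0 by simp
      then have "-1 * k \<le> x * k" "x * k \<le> 1 * k"
        using x0 sf s k by linarith+
      ultimately have "0 \<le> y" "y \<le> 2" "-1 \<le> x" "x \<le> 1"
        using k mult_right_le_imp_le[of _ k] by (metis zero_less_one less_le_trans)+
      \<comment> \<open>This excludes the diagonal neighbour at the upper left: \<open>x < 0\<close>
        forces \<open>x0 \<le> s\<close>, so \<open>f + m * x0\<close> is at most
        \<open>1 + m * s = k\<close>.\<close>
      moreover have "y \<le> 1" if "x < 0"
      proof -
        have "x * k < 0"
          using that k by (simp add: mult_neg_pos)
        then have "x0 \<le> s"
          unfolding xk using e0 sf by simp
        then have "m * x0 \<le> m * s"
          using m by (simp add: mult_left_mono)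
        then have "y * k \<le> 1 * k"
          unfolding yk using e0 f by (simp add: k_def)
        then show ?thesis
          using k by simp
      qed
      ultimately show ?thesis by force
    qed
  qed (use xy x_def in auto)
qed

section \<open>Walks through the squares of the Ornithorynque\<close>

text \<open>
  A copy of the index set made of free constructors, on which \<open>code_simp\<close> is fast.
\<close>

datatype residue3 = R0 | R1 | R2

fun rsucc :: "residue3 \<Rightarrow> residue3" where
  "rsucc R0 = R1" | "rsucc R1 = R2" | "rsucc R2 = R0"

fun rpred :: "residue3 \<Rightarrow> residue3" where
  "rpred R0 = R2" | "rpred R1 = R0" | "rpred R2 = R1"

type_synonym sq = "residue3 \<times> bool \<times> bool"

fun sq_h :: "sq \<Rightarrow> sq" where
  "sq_h (i, False, False) = (rsucc i, True, False)"
| "sq_h (i, False, True) = (rpred i, True, True)"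
| "sq_h (i, True, k) = (i, False, k)"

fun sq_v :: "sq \<Rightarrow> sq" where
  "sq_v (i, False, False) = (rpred i, False, True)"
| "sq_v (i, True, False) = (rsucc i, True, True)"
| "sq_v (i, j, True) = (i, j, False)"

fun sq_h_inv :: "sq \<Rightarrow> sq" where
  "sq_h_inv (i, True, False) = (rpred i, False, False)"
| "sq_h_inv (i, True, True) = (rsucc i, False, True)"
| "sq_h_inv (i, False, k) = (i, True, k)"

text \<open>
  A line of slope in \<open>(-1, 0)\<close>, followed upwards, that enters the square \<open>p\<close> through its bottom side next enters, through
  the bottom side, the square above \<open>p\<close> or the one above the left neighbour of \<open>p\<close>. A line of slope
  above \<open>1\<close>, followed to the right, that enters \<open>q\<close> through its left side next enters, through the left side, the square to
  the right of \<open>q\<close>, or else the one to the right of the square above \<open>q\<close>, which it has entered through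
  the bottom side. So \<open>avoids n T p\<close> says that some walk of the first kind makes \<open>n\<close> steps from \<open>p\<close>
  outside \<open>T\<close>, and \<open>blocks n T q\<close> that every walk of the second kind with \<open>n\<close> steps from \<open>q\<close> meets,
  together with \<open>T\<close>, all walks of the first kind with four steps.
\<close>

fun avoids :: "nat \<Rightarrow> sq list \<Rightarrow> sq \<Rightarrow> bool" where
  "avoids 0 T p \<longleftrightarrow> p \<notin> set T"
| "avoids (Suc n) T p \<longleftrightarrow> p \<notin> set T \<and> (avoids n T (sq_v p) \<or> avoids n T (sq_v (sq_h_inv p)))"

definition all_sq :: "sq list" where
  "all_sq = List.product [R0, R1, R2] (List.product [False, True] [False, True])"

fun blocks :: "nat \<Rightarrow> sq list \<Rightarrow> sq \<Rightarrow> bool" where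
  "blocks 0 T q \<longleftrightarrow> (\<forall>p \<in> set all_sq. \<not> avoids 4 (q # T) p)"
| "blocks (Suc n) T q \<longleftrightarrow> blocks n (q # T) (sq_h q) \<and> blocks n (sq_v q # q # T) (sq_h (sq_v q))"

lemma set_all_sq: "set all_sq = UNIV"
proof -
  have "(i, j, k) \<in> set all_sq" for i j k
    by (cases i; cases j; cases k) (simp_all add: all_sq_def)
  then show ?thesis
    by auto
qed

text \<open>The exhaustive search: 32 walks of five steps from each of the 12 squares, each tested
  against the 16 walks of four steps from every square.\<close>

lemma blocks_all_sq: "\<forall>q \<in> set all_sq. blocks 5 [] q"
  by code_simp

lemma avoids_walk:
  assumes "\<And>i. i < n \<Longrightarrow> p (k + Suc i) = sq_v (p (k + i)) \<or> p (k + Suc i) = sq_v (sq_h_inv (p (k + i)))"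
    and "\<And>i. i \<le> n \<Longrightarrow> p (k + i) \<notin> set T"
  shows "avoids n T (p k)"
  using assms
proof (induction n arbitrary: k)
  case 0
  then show ?case by force
next
  case (Suc n)
  have "avoids n T (p (Suc k))"
    by (rule Suc.IH) (use Suc.prems(1)[of "Suc _"] Suc.prems(2)[of "Suc _"] in auto)
  then show ?case
    using Suc.prems(1)[of 0] Suc.prems(2)[of 0] by auto
qed

text \<open>Soundness of the search for an actual walk \<open>q\<close>: \<open>T\<close> collects
  members of \<open>W\<close> met so far, and the branch taken by \<open>q\<close> ends in a list
  that no walk of the first kind with four steps avoids.\<close>

lemma blocks_walk:
  assumes "blocks n T (q k)" "set T \<subseteq> W"
    and "\<And>i. i \<le> n \<Longrightarrow> q (k + i) \<in> W"
    and "\<And>i. i < n \<Longrightarrow> q (k + Suc i) = sq_h (q (k + i)) \<or>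
      q (k + Suc i) = sq_h (sq_v (q (k + i))) \<and> sq_v (q (k + i)) \<in> W"
  shows "\<exists>T'. set T' \<subseteq> W \<and> (\<forall>p. \<not> avoids 4 T' p)"
  using assms
proof (induction n arbitrary: k T)
  case 0
  then have "set (q k # T) \<subseteq> W" "\<forall>p. \<not> avoids 4 (q k # T) p"
    using 0(3)[of 0] by (auto simp: set_all_sq)
  then show ?case by blast
next
  case (Suc n)
  have qk: "q k \<in> W"
    using Suc.prems(3)[of 0] by simp
  have step: "\<exists>T'. set T' \<subseteq> W \<and> (\<forall>p. \<not> avoids 4 T' p)"
    if "blocks n T' (q (Suc k))" "set T' \<subseteq> W" for T'
    by (rule Suc.IH[OF that]) (use Suc.prems(3)[of "Suc _"] Suc.prems(4)[of "Suc _"] in auto)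
  from Suc.prems(4)[of 0] consider "q (Suc k) = sq_h (q k)"
    | "q (Suc k) = sq_h (sq_v (q k))" "sq_v (q k) \<in> W"
    by auto
  then show ?case
  proof cases
    case 1
    then show ?thesis
      using step[of "q k # T"] Suc.prems(1,2) qk by simp
  next
    case 2
    then show ?thesis
      using step[of "sq_v (q k) # q k # T"] Suc.prems(1,2) qk by simp
  qed
qed

section \<open>Transfer to the index set of the Ornithorynque\<close>

fun sq_of :: "orni_index \<Rightarrow> sq" where
  "sq_of (i, j, k) = (if i = 0 then R0 else if i = 1 then R1 else R2, j \<noteq> 0, k \<noteq> 0)"

lemma sq_of_h: "sq_of (orni_h q) = sq_h (sq_of q)"
proof -
  obtain i j k where "q = (i, j, k)" by (cases q)
  then show ?thesis
    using index_3_cases[of i] index_2_cases[of j] index_2_cases[of k]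
    by (auto simp: orni_h_def)
qed

lemma sq_of_v: "sq_of (orni_v q) = sq_v (sq_of q)"
proof -
  obtain i j k where "q = (i, j, k)" by (cases q)
  then show ?thesis
    using index_3_cases[of i] index_2_cases[of j] index_2_cases[of k]
    by (auto simp: orni_v_def)
qed

lemma inj_sq_of: "inj sq_of"
proof (rule injI)
  fix p q assume *: "sq_of p = sq_of q"
  obtain i j k i' j' k' where "p = (i, j, k)" "q = (i', j', k')"
    by (cases p; cases q)
  with * show "p = q"
    using index_3_cases[of i] index_2_cases[of j] index_2_cases[of k]
      index_3_cases[of i'] index_2_cases[of j'] index_2_cases[of k']
    by (auto split: if_splits)
qed

lemma sq_h_inv_h: "sq_h_inv (sq_h p) = p"
proof -
  obtain i j k where "p = (i, j, k)" by (cases p)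
  then show ?thesis
    by (cases i; cases j; cases k) simp_all
qed

lemma orni_walks_meet:
  fixes p q :: "nat \<Rightarrow> orni_index"
  assumes p: "\<And>i. i < 4 \<Longrightarrow> p (Suc i) = orni_v (p i) \<or> (\<exists>r. orni_h r = p i \<and> p (Suc i) = orni_v r)"
    and qW: "\<And>i. i \<le> 5 \<Longrightarrow> q i \<in> W"
    and q: "\<And>i. i < 5 \<Longrightarrow> q (Suc i) = orni_h (q i) \<or>
      q (Suc i) = orni_h (orni_v (q i)) \<and> orni_v (q i) \<in> W"
  obtains i where "i \<le> 4" "p i \<in> W"
proof -
  have "blocks 5 [] ((sq_of \<circ> q) 0)"
    using blocks_all_sq unfolding set_all_sq by blast
  then have "\<exists>T. set T \<subseteq> sq_of ` W \<and> (\<forall>p. \<not> avoids 4 T p)"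
  proof (rule blocks_walk)
    fix i :: nat assume "i < 5"
    from q[OF this] show "(sq_of \<circ> q) (0 + Suc i) = sq_h ((sq_of \<circ> q) (0 + i)) \<or>
      (sq_of \<circ> q) (0 + Suc i) = sq_h (sq_v ((sq_of \<circ> q) (0 + i))) \<and> sq_v ((sq_of \<circ> q) (0 + i)) \<in> sq_of ` W"
      by (elim disjE) (simp_all flip: sq_of_h sq_of_v)
  qed (use qW in auto)
  then obtain T where T: "set T \<subseteq> sq_of ` W" "\<And>p. \<not> avoids 4 T p"
    by blast
  \<comment> \<open>The condition \<open>orni_h r = p i\<close> on the left neighbour
    \<open>r\<close> becomes \<open>sq_of r = sq_h_inv (sq_of (p i))\<close> by
    \<open>sq_h_inv_h\<close>.\<close>
  have "p' (0 + Suc i) = sq_v (p' (0 + i)) \<or> p' (0 + Suc i) = sq_v (sq_h_inv (p' (0 + i)))"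
    if "i < 4" "p' = sq_of \<circ> p" for i p'
    using p[OF that(1)] unfolding that(2) by (metis add_0 comp_apply sq_h_inv_h sq_of_h sq_of_v)
  \<comment> \<open>Otherwise \<open>avoids_walk\<close> would make \<open>p\<close> a walk avoiding
    \<open>T\<close>.\<close>
  then obtain i where "i \<le> 4" "sq_of (p i) \<in> set T"
    using avoids_walk[of 4 "sq_of \<circ> p" 0 T] T(2) by auto
  then have "p i \<in> W"
    using T(1) inj_sq_of by (auto dest: injD)
  with \<open>i \<le> 4\<close> that show ?thesis by blast
qed

section \<open>Walks of long segments\<close>

lemma develops_mono: "develops h v \<sigma> L S \<Longrightarrow> L' \<subseteq> L \<Longrightarrow> develops h v \<sigma> L' S"
  unfolding develops_def by fast

lemma affine_image_interval:
  fixes c r l :: real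
  assumes "r \<noteq> 0" "l \<le> (b - a) * \<bar>r\<bar>"
  obtains A where "{A<..<A + l} \<subseteq> (\<lambda>t. c + t * r) ` {a<..<b}"
\<comment> \<open>For \<open>r < 0\<close> the interval is traversed downwards, so its left endpoint
  is the image of \<open>b\<close>.\<close>
proof (rule that[of "if r > 0 then c + a * r else c + b * r"], rule subsetI)
  fix y assume y: "y \<in> {if r > 0 then c + a * r else c + b * r<..<(if r > 0 then c + a * r else c + b * r) + l}"
  have "(y - c) / r \<in> {a<..<b}"
    using y assms by (auto simp: field_simps split: if_splits)
  moreover have "y = c + (y - c) / r * r"
    using assms(1) by simp
  ultimately show "y \<in> (\<lambda>t. c + t * r) ` {a<..<b}"
    by blast
qed

text \<open>Turns a lower bound on the length of a segment into one on its extent in the dominant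
  coordinate.\<close>

lemma norm_Pair_le_sqrt2:
  fixes x y :: real
  assumes "\<bar>x\<bar> \<le> \<bar>y\<bar>"
  shows "norm (x, y) \<le> sqrt 2 * \<bar>y\<bar>" "norm (y, x) \<le> sqrt 2 * \<bar>y\<bar>"
proof -
  have "x\<^sup>2 \<le> y\<^sup>2"
    using assms by (simp add: abs_le_square_iff)
  then have "sqrt (x\<^sup>2 + y\<^sup>2) \<le> sqrt (2 * y\<^sup>2)"
    by simp
  then show "norm (x, y) \<le> sqrt 2 * \<bar>y\<bar>" "norm (y, x) \<le> sqrt 2 * \<bar>y\<bar>"
    by (simp_all add: norm_Pair real_sqrt_mult add.commute)
qed

lemma segment_steep_line:
  assumes bij: "bij h" "bij v" and seg: "segment h v a b u S"
    and slope: "-1 < slope u" "slope u < 0" and len: "sqrt 2 * l \<le> segment_length a b u"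
  obtains s \<xi> A \<sigma> where "0 < s" "s < 1" "develops h v \<sigma> (steep_line s \<xi> {A<..<A + l}) (S ` {a<..<b})"
proof -
  obtain p r where u: "u = (p, r)" by (cases u)
  \<comment> \<open>For \<open>r = 0\<close> the slope is \<open>\<infinity>\<close>,
    \<open>-\<infinity>\<close> or, for the zero vector, \<open>0 / 0 = 0\<close> in
    \<open>ereal\<close>; none of these lies strictly between \<open>-1\<close> and
    \<open>0\<close>.\<close>
  have r: "r \<noteq> 0"
    using slope by (cases p "0 :: real" rule: linorder_cases) (auto simp: u slope_horizontal slope_def)
  define s where "s = - (p / r)"
  have "ereal (-1) < ereal (p / r)" "ereal (p / r) < ereal 0"
    using slope by (simp_all only: u slope_finite[OF r] one_ereal_def uminus_ereal.simps zero_ereal_def)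
  then have s: "0 < s" "s < 1"
    by (simp_all add: s_def)
  have p: "p = - s * r"
    using r by (simp add: s_def)
  then have "\<bar>p\<bar> \<le> \<bar>r\<bar>"
    using s by (simp add: abs_mult mult_left_le_one_le)
  have ab: "a < b"
    using seg by (simp add: segment_def)
  have "sqrt 2 * l \<le> (b - a) * norm (p, r)"
    using len ab by (simp add: segment_length_def u)
  also have "\<dots> \<le> (b - a) * (sqrt 2 * \<bar>r\<bar>)"
    using norm_Pair_le_sqrt2(1)[OF \<open>\<bar>p\<bar> \<le> \<bar>r\<bar>\<close>] ab by (intro mult_left_mono) auto
  finally have "sqrt 2 * l \<le> sqrt 2 * ((b - a) * \<bar>r\<bar>)"
    by (simp only: ac_simps)
  then have l: "l \<le> (b - a) * \<bar>r\<bar>"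
    by simp
  obtain c \<sigma> where dev: "develops h v \<sigma> ((\<lambda>t. c + t *\<^sub>R u) ` {a<..<b}) (S ` {a<..<b})"
    using segment_develops[OF bij seg] .
  obtain c1 c2 where c: "c = (c1, c2)" by (cases c)
  obtain A where A: "{A<..<A + l} \<subseteq> (\<lambda>t. c2 + t * r) ` {a<..<b}"
    using affine_image_interval[OF r l] .
  \<comment> \<open>The height replaces \<open>t\<close> as parameter; the intercept is fixed by the
    line passing through \<open>c\<close>.\<close>
  have "steep_line s (c1 + s * c2) {A<..<A + l} \<subseteq> (\<lambda>t. c + t *\<^sub>R u) ` {a<..<b}"
  proof
    fix z assume "z \<in> steep_line s (c1 + s * c2) {A<..<A + l}"
    then obtain y where z: "z = (c1 + s * c2 - s * y, y)" and "y \<in> {A<..<A + l}"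
      by (auto simp: steep_line_def)
    then obtain t where t: "t \<in> {a<..<b}" "y = c2 + t * r"
      using A by blast
    then have "z = c + t *\<^sub>R u"
      by (simp add: z c u p algebra_simps)
    with t(1) show "z \<in> (\<lambda>t. c + t *\<^sub>R u) ` {a<..<b}"
      by blast
  qed
  with s that develops_mono[OF dev] show ?thesis
    by blast
qed

lemma segment_flat_line:
  assumes bij: "bij h" "bij v" and seg: "segment h v a b u S"
    and slope: "1 < slope u" and len: "sqrt 2 * l \<le> segment_length a b u"
  obtains m \<beta> A \<sigma> where "0 \<le> m" "m < 1" "develops h v \<sigma> (flat_line m \<beta> {A<..<A + l}) (S ` {a<..<b})"
proof -
  obtain p r where u: "u = (p, r)" by (cases u)
  have "p \<noteq> 0 \<and> 0 \<le> r / p \<and> r / p < 1"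
  proof (cases "r = 0")
    case True
    then show ?thesis
      using slope by (cases p "0 :: real" rule: linorder_cases) (auto simp: u slope_horizontal slope_def)
  next
    case False
    then have "1 < p / r"
      using slope by (simp add: u slope_finite one_ereal_def)
    moreover have "r / p = 1 / (p / r)"
      by simp
    ultimately show ?thesis
      by (auto simp del: divide_divide_eq_right)
  qed
  then have p: "p \<noteq> 0"
    by simp
  define m where "m = r / p"
  have m: "0 \<le> m" "m < 1"
    using \<open>p \<noteq> 0 \<and> 0 \<le> r / p \<and> r / p < 1\<close> by (simp_all only: m_def)
  have r: "r = m * p"
    using p by (simp add: m_def)
  then have "\<bar>r\<bar> \<le> \<bar>p\<bar>"
    using m by (simp add: abs_mult mult_left_le_one_le)
  have ab: "a < b"
    using seg by (simp add: segment_def)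
  have "sqrt 2 * l \<le> (b - a) * norm (p, r)"
    using len ab by (simp add: segment_length_def u)
  also have "\<dots> \<le> (b - a) * (sqrt 2 * \<bar>p\<bar>)"
    using norm_Pair_le_sqrt2(2)[OF \<open>\<bar>r\<bar> \<le> \<bar>p\<bar>\<close>] ab by (intro mult_left_mono) auto
  finally have "sqrt 2 * l \<le> sqrt 2 * ((b - a) * \<bar>p\<bar>)"
    by (simp only: ac_simps)
  then have l: "l \<le> (b - a) * \<bar>p\<bar>"
    by simp
  obtain c \<sigma> where dev: "develops h v \<sigma> ((\<lambda>t. c + t *\<^sub>R u) ` {a<..<b}) (S ` {a<..<b})"
    using segment_develops[OF bij seg] .
  obtain c1 c2 where c: "c = (c1, c2)" by (cases c)
  obtain A where A: "{A<..<A + l} \<subseteq> (\<lambda>t. c1 + t * p) ` {a<..<b}"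
    using affine_image_interval[OF p l] .
  have "flat_line m (c2 - m * c1) {A<..<A + l} \<subseteq> (\<lambda>t. c + t *\<^sub>R u) ` {a<..<b}"
  proof
    fix z assume "z \<in> flat_line m (c2 - m * c1) {A<..<A + l}"
    then obtain x where z: "z = (x, c2 - m * c1 + m * x)" and "x \<in> {A<..<A + l}"
      by (auto simp: flat_line_def)
    then obtain t where t: "t \<in> {a<..<b}" "x = c1 + t * p"
      using A by blast
    then have "z = c + t *\<^sub>R u"
      by (simp add: z c u r algebra_simps)
    with t(1) show "z \<in> (\<lambda>t. c + t *\<^sub>R u) ` {a<..<b}"
      by blast
  qed
  with m that develops_mono[OF dev] show ?thesis
    by blast
qed

text \<open>Climbing one unit moves the line to the left by \<open>s < 1\<close>, so its column
  \<open>N\<close> drops by at most one.\<close>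

lemma steep_line_step:
  assumes dev: "develops h v \<sigma> (steep_line s \<xi> I) S" and I: "convex I" "of_int j \<in> I" "of_int j + 1 \<in> I"
    and s: "0 < s" "s < 1"
  defines "N \<equiv> \<lambda>j. \<lfloor>\<xi> - s * of_int j\<rfloor>"
  shows "\<sigma> (N (j + 1)) (j + 1) = v (\<sigma> (N j) j) \<or>
    (\<exists>r. h r = \<sigma> (N j) j \<and> \<sigma> (N (j + 1)) (j + 1) = v r)"
proof -
  note conv = convex_steep_line[OF I(1), of s \<xi>]
  let ?x = "\<xi> - s * of_int j"
  let ?x' = "\<xi> - s * (of_int j + 1)"
  have x': "?x' = ?x - s"
    by (simp add: algebra_simps)
  have N: "of_int (N j) \<le> ?x" "?x < of_int (N j) + 1"
    by (auto simp: N_def)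
  have L: "(?x, of_int j) \<in> steep_line s \<xi> I" "(?x', of_int j + 1) \<in> steep_line s \<xi> I"
    using I by (auto simp: in_steep_line)
  have N': "of_int (N (j + 1)) \<le> ?x'" "?x' < of_int (N (j + 1)) + 1"
    unfolding N_def by (simp_all add: floor_less_iff)
  have "N (j + 1) = N j \<or> N (j + 1) = N j - 1"
    using N N' x' s by linarith
  then show ?thesis
  proof
    assume eq: "N (j + 1) = N j"
    have "\<sigma> (N j) (j + 1) = v (\<sigma> (N j) j)"
      by (rule develops_up[OF dev conv L(1) _ L(2)]) (use N N' eq in \<open>auto simp: in_cell_iff\<close>)
    with eq show ?thesis by simp
  next
    assume eq: "N (j + 1) = N j - 1"
    \<comment> \<open>Cells are closed: the upper point lies on the top side of the cell in column
      \<open>N j - 1\<close> and row \<open>j\<close>, so this cell is visited and links the two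
      labels.\<close>
    have "\<sigma> (N j - 1 + 1) j = h (\<sigma> (N j - 1) j)"
      by (rule develops_right[OF dev conv L(2) _ L(1)]) (use N N' eq in \<open>auto simp: in_cell_iff\<close>)
    moreover have "\<sigma> (N j - 1) (j + 1) = v (\<sigma> (N j - 1) j)"
      by (rule develops_up[OF dev conv L(2) _ L(2)]) (use N N' eq in \<open>auto simp: in_cell_iff\<close>)
    ultimately show ?thesis
      using eq by auto
  qed
qed

text \<open>One unit to the right raises the line by \<open>m < 1\<close>, so its row
  \<open>R\<close> grows by at most one. If it grows, the last conjunct records where the line
  enters the upper cell through its bottom side, so that this square can be counted as entered
  too.\<close>

lemma flat_line_step:
  assumes dev: "develops h v \<tau> (flat_line m \<beta> I) S" and I: "convex I" "of_int n \<in> I" "of_int n + 1 \<in> I"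
    and m: "0 \<le> m" "m < 1"
  defines "R \<equiv> \<lambda>n. \<lfloor>\<beta> + m * of_int n\<rfloor>"
  shows "\<tau> (n + 1) (R (n + 1)) = h (\<tau> n (R n)) \<or>
    \<tau> (n + 1) (R (n + 1)) = h (v (\<tau> n (R n))) \<and> v (\<tau> n (R n)) = \<tau> n (R n + 1) \<and>
    (\<exists>e. 0 \<le> e \<and> e \<le> 1 \<and> (of_int n + e, of_int (R n + 1)) \<in> flat_line m \<beta> I)"
proof -
  note conv = convex_flat_line[OF I(1), of m \<beta>]
  let ?y = "\<beta> + m * of_int n"
  let ?y' = "\<beta> + m * (of_int n + 1)"
  have y': "?y' = ?y + m"
    by (simp add: algebra_simps)
  have R: "of_int (R n) \<le> ?y" "?y < of_int (R n) + 1"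
    by (auto simp: R_def)
  have L: "(of_int n, ?y) \<in> flat_line m \<beta> I" "(of_int n + 1, ?y') \<in> flat_line m \<beta> I"
    using I by (auto simp: in_flat_line)
  have R': "of_int (R (n + 1)) \<le> ?y'" "?y' < of_int (R (n + 1)) + 1"
    unfolding R_def by (simp_all add: floor_less_iff)
  have "R (n + 1) = R n \<or> R (n + 1) = R n + 1"
    using R R' y' m by linarith
  then show ?thesis
  proof
    assume eq: "R (n + 1) = R n"
    have "\<tau> (n + 1) (R n) = h (\<tau> n (R n))"
      by (rule develops_right[OF dev conv L(1) _ L(2)]) (use R R' eq in \<open>auto simp: in_cell_iff\<close>)
    with eq show ?thesis by simp
  next
    assume eq: "R (n + 1) = R n + 1"
    have m0: "m > 0"
      using eq R R' y' m by (cases "m = 0") auto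
    have up: "\<tau> n (R n + 1) = v (\<tau> n (R n))"
      by (rule develops_up[OF dev conv L(1) _ L(2)]) (use R R' eq in \<open>auto simp: in_cell_iff\<close>)
    have right: "\<tau> (n + 1) (R n + 1) = h (\<tau> n (R n + 1))"
      by (rule develops_right[OF dev conv L(2) _ L(2)]) (use R R' eq in \<open>auto simp: in_cell_iff\<close>)
    \<comment> \<open>The horizontal offset at which the line reaches height
      \<open>R n + 1\<close>.\<close>
    define e where "e = (of_int (R n) + 1 - ?y) / m"
    have em: "m * e = of_int (R n) + 1 - ?y"
      using m0 by (simp add: e_def)
    have e: "0 \<le> e" "e \<le> 1"
      using R R' eq y' m0 by (auto simp: e_def divide_le_eq)
    have "(1 - e) *\<^sub>R of_int n + e *\<^sub>R (of_int n + 1) \<in> I"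
      using e by (intro convexD[OF I(1) I(2) I(3)]) auto
    then have "of_int n + e \<in> I"
      by (simp add: algebra_simps)
    then have "(of_int n + e, of_int (R n + 1)) \<in> flat_line m \<beta> I"
      using em by (simp add: in_flat_line algebra_simps)
    with e up right eq show ?thesis by auto
  qed
qed

lemma lines_same_square_meet:
  assumes inj: "inj h" "inj v"
    and H: "develops h v \<sigma> (steep_line s \<xi> I) S" "convex I" "of_int j - 1 \<in> I" "of_int j + 2 \<in> I"
    and V: "develops h v \<tau> (flat_line m \<beta> J) T" "convex J" "of_int n' - 1 \<in> J" "of_int n' + 1 \<in> J"
    and s: "0 < s" "s < 1" and m: "0 \<le> m" "m < 1"
    and same: "\<sigma> n j = \<tau> n' j'"
    and x0: "0 \<le> x0" "x0 \<le> 1" "(of_int n + x0, of_int j) \<in> steep_line s \<xi> I"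
    and ef: "(e, f) \<in> unit_square" "e = 0 \<or> f = 0" "(of_int n' + e, of_int j' + f) \<in> flat_line m \<beta> J"
  shows "S \<inter> T \<noteq> {}"
proof -
  have "0 \<le> e" "e \<le> 1" "0 \<le> f" "f \<le> 1"
    using ef(1) by auto
  then obtain x y where xy: "x = x0 - s * y" "y = f + m * (x - e)"
    "(x, y) \<in> {0..1} \<times> {-1..2} \<union> {-1..1} \<times> {0..1}"
    using line_intersection_near[OF s m x0(1,2) _ _ _ _ ef(2)] by metis
  \<comment> \<open>Relative to the square, the crossing has height in \<open>[-1, 2]\<close> and
    abscissa in \<open>[-1, 1]\<close>; the extra points assumed in \<open>I\<close> and
    \<open>J\<close> keep it on both lines.\<close>
  have "of_int j + y \<in> {of_int j - 1..of_int j + 2}" "of_int n' + x \<in> {of_int n' - 1..of_int n' + 1}"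
    using xy(3) by auto
  then have I: "of_int j + y \<in> I" and J: "of_int n' + x \<in> J"
    using H(2-4) V(2-4) unfolding is_interval_convex_1[symmetric] is_interval_1
    by (meson atLeastAtMost_iff)+
  have "of_int n + x = \<xi> - s * (of_int j + y)"
    using x0(3) xy(1) by (simp add: in_steep_line algebra_simps)
  moreover have "of_int j' + y = \<beta> + m * (of_int n' + x)"
    using ef(3) xy(2) by (simp add: in_flat_line algebra_simps)
  ultimately have meet: "(of_int n + x, of_int j + y) \<in> steep_line s \<xi> I"
    "(of_int n' + x, of_int j' + y) \<in> flat_line m \<beta> J"
    using I J by (simp_all only: in_steep_line in_flat_line)
  show ?thesis
  proof (rule develops_meet[OF inj H(1) convex_steep_line[OF H(2)] V(1) convex_flat_line[OF V(2)] same
        _ ef(3) _ ef(1) meet])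
    show "(of_int n + x0, of_int j + 0) \<in> steep_line s \<xi> I" "(x0, 0) \<in> unit_square"
      using x0 by simp_all
    show "(x, y) \<in> {0..1} \<times> {-1..2} \<union> {-1..2} \<times> {0..1}"
      using xy(3) by auto
  qed
qed

theorem corollary3p2:
  fixes H V :: "real \<Rightarrow> (orni_index \<times> real \<times> real) set"
    and a b c d :: real and u w :: "real \<times> real"
  assumes "segment orni_h orni_v a b u H"
    and "segment orni_h orni_v c d w V"
    and "-1 < slope u" and "slope u < 0"
    and "slope w > 1"
    and "segment_length a b u \<ge> sqrt 288"
    and "segment_length c d w \<ge> sqrt 288"
  shows "H ` {a<..<b} \<inter> V ` {c<..<d} \<noteq> {}"
proof -
  have "sqrt 288 = sqrt (2 * 12\<^sup>2)"
    by simp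
  then have sqrt: "sqrt 288 = sqrt 2 * 12"
    by (simp only: real_sqrt_mult real_sqrt_power) simp
  obtain s \<xi> A \<sigma> where s: "0 < s" "s < 1"
    and H: "develops orni_h orni_v \<sigma> (steep_line s \<xi> {A<..<A + 12}) (H ` {a<..<b})"
    using segment_steep_line[OF bij_orni_h bij_orni_v assms(1,3,4)] assms(6) unfolding sqrt by metis
  obtain m \<beta> C \<tau> where m: "0 \<le> m" "m < 1"
    and V: "develops orni_h orni_v \<tau> (flat_line m \<beta> {C<..<C + 12}) (V ` {c<..<d})"
    using segment_flat_line[OF bij_orni_h bij_orni_v assms(2,5)] assms(7) unfolding sqrt by metis
  \<comment> \<open>Rows \<open>j0\<close> to \<open>j0 + 4\<close> need one spare unit below and
    two above for the crossing, columns \<open>n0\<close> to \<open>n0 + 5\<close> one on each side: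
    in both cases the range from \<open>- 1\<close> to \<open>+ 6\<close>. Adding 2 to the floor
    puts \<open>j0 - 1\<close> above \<open>A\<close>.\<close>
  define j0 where "j0 = \<lfloor>A\<rfloor> + 2"
  define n0 where "n0 = \<lfloor>C\<rfloor> + 2"
  have j0: "A < of_int j0 - 1" "of_int j0 + 6 < A + 12" and n0: "C < of_int n0 - 1" "of_int n0 + 6 < C + 12"
    unfolding j0_def n0_def by linarith+
  define N where "N j = \<lfloor>\<xi> - s * of_int j\<rfloor>" for j :: int
  define R where "R n = \<lfloor>\<beta> + m * of_int n\<rfloor>" for n :: int
  \<comment> \<open>\<open>p i\<close> is the square that \<open>H\<close> enters through its bottom
    side at height \<open>j0 + i\<close>, and \<open>q i\<close> the one that \<open>V\<close>
    enters through its left side at abscissa \<open>n0 + i\<close>.\<close>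
  define p where "p i = \<sigma> (N (j0 + int i)) (j0 + int i)" for i
  define q where "q i = \<tau> (n0 + int i) (R (n0 + int i))" for i
  \<comment> \<open>All squares that \<open>V\<close> enters in these columns through the left side
    (\<open>e = 0\<close>) or the bottom side (\<open>f = 0\<close>), each kept with its entry point
    for \<open>line_intersection_near\<close>.\<close>
  define W where "W = {\<tau> n j |n j e f. n0 \<le> n \<and> n \<le> n0 + 5 \<and> (e, f) \<in> unit_square \<and> (e = 0 \<or> f = 0) \<and>
    (of_int n + e, of_int j + f) \<in> flat_line m \<beta> {C<..<C + 12}}"
  have pstep: "p (Suc i) = orni_v (p i) \<or> (\<exists>r. orni_h r = p i \<and> p (Suc i) = orni_v r)" if "i < 4" for i
  proof -
    have "of_int (j0 + int i) \<in> {A<..<A + 12}" "of_int (j0 + int i) + 1 \<in> {A<..<A + 12}"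
      using j0 that by auto
    from steep_line_step[OF H _ this s] show ?thesis
      by (simp add: p_def N_def ac_simps)
  qed
  have qW: "q i \<in> W" if "i \<le> 5" for i
  proof -
    let ?n = "n0 + int i"
    define f where "f = \<beta> + m * of_int ?n - of_int (R ?n)"
    have "0 \<le> f" "f \<le> 1"
      unfolding f_def R_def by linarith+
    moreover have "(of_int ?n + 0, of_int (R ?n) + f) \<in> flat_line m \<beta> {C<..<C + 12}"
      using n0 that by (auto simp: in_flat_line f_def)
    ultimately show ?thesis
      unfolding W_def q_def using that
      by (intro CollectI exI[of _ ?n] exI[of _ "R ?n"] exI[of _ 0] exI[of _ f]) auto
  qed
  have qstep: "q (Suc i) = orni_h (q i) \<or>
      q (Suc i) = orni_h (orni_v (q i)) \<and> orni_v (q i) \<in> W" if "i < 5" for i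
  proof -
    let ?n = "n0 + int i"
    have I: "of_int ?n \<in> {C<..<C + 12}" "of_int ?n + 1 \<in> {C<..<C + 12}"
      using n0 that by auto
    have Suc: "n0 + int (Suc i) = ?n + 1"
      by simp
    have "\<tau> ?n (R ?n + 1) \<in> W"
      if "0 \<le> e" "e \<le> 1" "(of_int ?n + e, of_int (R ?n + 1)) \<in> flat_line m \<beta> {C<..<C + 12}" for e
      unfolding W_def using that \<open>i < 5\<close>
      by (intro CollectI exI[of _ ?n] exI[of _ "R ?n + 1"] exI[of _ e] exI[of _ 0]) auto
    with flat_line_step[OF V _ I m] show ?thesis
      unfolding q_def Suc R_def by auto
  qed
  obtain i where i: "i \<le> 4" "p i \<in> W"
    using orni_walks_meet[of p q W] pstep qW qstep by metis
  then obtain n j e f where W: "p i = \<tau> n j" "n0 \<le> n" "n \<le> n0 + 5" "(e, f) \<in> unit_square" "e = 0 \<or> f = 0"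
    "(of_int n + e, of_int j + f) \<in> flat_line m \<beta> {C<..<C + 12}"
    unfolding W_def by blast
  let ?j = "j0 + int i"
  define x0 where "x0 = \<xi> - s * of_int ?j - of_int (N ?j)"
  have x0: "0 \<le> x0" "x0 \<le> 1"
    unfolding x0_def N_def by linarith+
  have base: "(of_int (N ?j) + x0, of_int ?j) \<in> steep_line s \<xi> {A<..<A + 12}"
    using j0 i(1) by (auto simp: in_steep_line x0_def)
  show ?thesis
  proof (rule lines_same_square_meet[OF bij_is_inj[OF bij_orni_h] bij_is_inj[OF bij_orni_v]
        H _ _ _ V _ _ _ s m _ x0 base W(4-6)])
    show "\<sigma> (N ?j) ?j = \<tau> n j"
      using W(1) by (simp add: p_def)
  qed (use j0 n0 i(1) W(2,3) in auto)
qed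

end
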